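(* Let $H$ be a Hilbert space, let $\mathcal{A}\subset L(H)$ be a commutative $C^*$-algebra with $1\in\mathcal{A}$, and let $U\in L(H)$ be a partial isometry such that $\delta(a)=UaU^*$ is an endomorphism of $\mathcal{A}$ and $U^*U\in\mathcal{A}'$. Let $\alpha:\Delta\to M(\mathcal{A})$ be the partial mapping associated with $\delta$, and put $$\widehat{M}_N=\{\widetilde{x}=(x_0,x_1,\dots,x_N,0,0,\dots):\ x_N\in\Delta_N,\ x_N\notin\Delta_{-1},\ \alpha(x_n)=x_{n-1}\ (1\le n\le N)\},\qquad N=0,1,2,\dots,$$ $$M_\infty=\{\widetilde{x}=(x_0,x_1,\dots):\ x_n\in\Delta_n\ (n\ge 0),\ \alpha(x_n)=x_{n-1}\ (n\ge 1)\}.$$ Identify each $\widetilde{x}\in M(\overline{E_*(\mathcal{A})})$ with the sequence $(\xi^0_{\widetilde{x}},\xi^1_{\widetilde{x}},\dots)$ (this assignment is injective). Then $$\bigcup_{N=0}^\infty\widehat{M}_N\cup M_\infty\subset M(\overline{E_*(\mathcal{A})}),$$ that is, every sequence belonging to some $\widehat{M}_N$ or to $M_\infty$ equals $(\xi^0_{\widetilde{x}},\xi^1_{\widetilde{x}},\dots)$ for some $\widetilde{x}\in M(\overline{E_*(\mathcal{A})})$.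
   Context: $L(H)$ is the algebra of bounded operators on $H$, $1$ is its identity, and $\mathcal{A}'$ is the commutant of $\mathcal{A}$ in $L(H)$. Endomorphisms are $*$-homomorphisms into the same algebra, not necessarily unital. For a unital commutative $C^*$-algebra $\mathcal{B}$, $M(\mathcal{B})$ is its maximal ideal space, i.e. the space of nonzero multiplicative linear functionals with the weak-$*$ topology. $\mathcal{B}$ is identified with $C(M(\mathcal{B}))$ by the Gelfand transform, so $a(x)=x(a)$ for $a\in\mathcal{B}$, $x\in M(\mathcal{B})$. The partial mapping: $\Delta=\{\tau\in M(\mathcal{A}):\tau(UU^* )=1\}$ is closed and open, and $\alpha:\Delta\to M(\mathcal{A})$, $\alpha(\tau)=\tau\circ\delta$, is continuous; equivalently, for $f\in C(M(\mathcal{A}))$, $(\delta f)(x)=f(\alpha(x))$ if $x\in\Delta$ and $(\delta f)(x)=0$ if $x\notin\Delta$. For $n\ge 0$, $\Delta_n=\alpha^{-n}(M(\mathcal{A}))$ is the set on which $\alpha^n$ is defined (so $\Delta_0=M(\mathcal{A})$, $\Delta_1=\Delta$), and for $n\ge 1$, $\Delta_{-n}=\alpha^n(\Delta_n)$ is the image of $\alpha^n$; in particular $\Delta_{-1}=\alpha(\Delta)$. The coefficient algebra: $\delta_*(x)=U^*xU$ for $x\in L(H)$, $\delta_*^0(x)=x$, and $\overline{E_*(\mathcal{A})}$ is the $C^*$-algebra generated by $\bigcup_{n=0}^\infty\delta_*^n(\mathcal{A})$. It is known that under the present hypotheses $\overline{E_*(\mathcal{A})}$ is commutative and that both $\delta$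 and $\delta_*$ restrict to endomorphisms of it. For $\widetilde{x}\in M(\overline{E_*(\mathcal{A})})$ and $n\ge 0$, the functional $\xi^n_{\widetilde{x}}:\mathcal{A}\to\mathbb{C}$ is $\xi^n_{\widetilde{x}}(a)=\widetilde{x}(\delta_*^n(a))=\widetilde{x}(U^{*n}aU^n)$. It is multiplicative and linear, so it is either an element $x_n\in M(\mathcal{A})$ or the zero functional (written $0$). *)

theory Defs
  imports "HOL-Analysis.Analysis"
begin

section \<open>Complex Hilbert spaces and their bounded operators\<close>

text \<open>
  The inner product is linear in its first argument. Since \<^term>\<open>norm\<close> is a norm,
  \<open>cinner_self\<close> contains the positive definiteness of \<open>cinner\<close>, and it says that the
  norm (for which the space is complete) is the one induced by \<open>cinner\<close>.
\<close>

class complex_hilbert_space = banach +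
  fixes scaleC :: "complex \<Rightarrow> 'a \<Rightarrow> 'a"  (infixr \<open>*\<^sub>C\<close> 75)
    and cinner :: "'a \<Rightarrow> 'a \<Rightarrow> complex"
  assumes scaleC_add_right: "c *\<^sub>C (x + y) = c *\<^sub>C x + c *\<^sub>C y"
    and scaleC_add_left: "(c + d) *\<^sub>C x = c *\<^sub>C x + d *\<^sub>C x"
    and scaleC_scaleC: "c *\<^sub>C d *\<^sub>C x = (c * d) *\<^sub>C x"
    and scaleC_of_real: "complex_of_real r *\<^sub>C x = r *\<^sub>R x"
    and cinner_commute: "cinner x y = cnj (cinner y x)"
    and cinner_add_left: "cinner (x + y) z = cinner x z + cinner y z"
    and cinner_scaleC_left: "cinner (c *\<^sub>C x) y = c * cinner x y"
    and cinner_self: "cinner x x = complex_of_real ((norm x)\<^sup>2)"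

instantiation complex :: complex_hilbert_space
begin
definition scaleC_complex :: "complex \<Rightarrow> complex \<Rightarrow> complex" where "scaleC_complex c x = c * x"
definition cinner_complex :: "complex \<Rightarrow> complex \<Rightarrow> complex" where "cinner_complex x y = x * cnj y"
instance
proof
  fix x :: complex
  show "cinner x x = complex_of_real ((norm x)\<^sup>2)"
    unfolding cinner_complex_def by (rule complex_norm_square[symmetric])
qed (simp_all add: scaleC_complex_def cinner_complex_def distrib_left distrib_right
      scaleR_conv_of_real)
end

lemma norm_scaleC: "norm (c *\<^sub>C x) = cmod c * norm (x :: 'h::complex_hilbert_space)"
proof -
  have "complex_of_real ((norm (c *\<^sub>C x))\<^sup>2) = c * cinner x (c *\<^sub>C x)"
    by (simp only: cinner_self[symmetric] cinner_scaleC_left)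
  also have "cinner x (c *\<^sub>C x) = cnj (c * cinner x x)"
    by (subst cinner_commute) (simp only: cinner_scaleC_left)
  also have "c * cnj (c * cinner x x) = (c * cnj c) * complex_of_real ((norm x)\<^sup>2)"
    by (simp only: cinner_self complex_cnj_mult complex_cnj_complex_of_real mult.assoc)
  also have "\<dots> = complex_of_real ((cmod c * norm x)\<^sup>2)"
    by (simp only: complex_norm_square[symmetric] of_real_mult[symmetric] power_mult_distrib)
  finally have "(norm (c *\<^sub>C x))\<^sup>2 = (cmod c * norm x)\<^sup>2"
    by (simp only: of_real_eq_iff)
  then show ?thesis
    by (simp add: power2_eq_iff_nonneg)
qed

lemma bounded_linear_scaleC: "bounded_linear (\<lambda>x. c *\<^sub>C (x :: 'h::complex_hilbert_space))"
proof (rule bounded_linear_intro[where K = "cmod c"])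
  fix r :: real and x :: 'h
  show "c *\<^sub>C r *\<^sub>R x = r *\<^sub>R c *\<^sub>C x"
    by (simp only: scaleC_of_real[symmetric] scaleC_scaleC mult.commute)
qed (simp_all add: scaleC_add_right norm_scaleC mult.commute)

text \<open>
  The library type \<^typ>\<open>'h \<Rightarrow>\<^sub>L 'h\<close> consists of the bounded \<^emph>\<open>real\<close>-linear operators,
  with the operator norm; \<open>L(H)\<close> is its subset of complex-linear operators.
  Products are \<^term>\<open>(o\<^sub>L)\<close> and the identity is \<^term>\<open>id_blinfun\<close>.
\<close>

definition bounded_ops :: "('h::complex_hilbert_space \<Rightarrow>\<^sub>L 'h) set" where
  "bounded_ops = {T. \<forall>c x. blinfun_apply T (c *\<^sub>C x) = c *\<^sub>C blinfun_apply T x}"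

lift_definition scaleC_op ::
    "complex \<Rightarrow> ('h::complex_hilbert_space \<Rightarrow>\<^sub>L 'h) \<Rightarrow> ('h \<Rightarrow>\<^sub>L 'h)" is "\<lambda>c T x. c *\<^sub>C T x"
  by (rule bounded_linear_compose[OF bounded_linear_scaleC])

text \<open>For \<open>T \<in> bounded_ops\<close> the adjoint exists and is unique, by the Riesz representation theorem.\<close>

definition adj :: "('h::complex_hilbert_space \<Rightarrow>\<^sub>L 'h) \<Rightarrow> ('h \<Rightarrow>\<^sub>L 'h)" where
  "adj T = (THE S. S \<in> bounded_ops \<and>
     (\<forall>x y. cinner (blinfun_apply T x) y = cinner x (blinfun_apply S y)))"

text \<open>A partial isometry is isometric on the orthogonal complement of its kernel.\<close>

definition partial_isometry :: "('h::complex_hilbert_space \<Rightarrow>\<^sub>L 'h) \<Rightarrow> bool" where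
  "partial_isometry U \<longleftrightarrow> U \<in> bounded_ops \<and>
     (\<forall>x. (\<forall>y. blinfun_apply U y = 0 \<longrightarrow> cinner x y = 0) \<longrightarrow> norm (blinfun_apply U x) = norm x)"

definition commutant :: "('h::complex_hilbert_space \<Rightarrow>\<^sub>L 'h) set \<Rightarrow> ('h \<Rightarrow>\<^sub>L 'h) set" where
  "commutant A = {T \<in> bounded_ops. \<forall>a\<in>A. T o\<^sub>L a = a o\<^sub>L T}"


section \<open>C*-algebras of operators\<close>

definition cstar_subalgebra :: "('h::complex_hilbert_space \<Rightarrow>\<^sub>L 'h) set \<Rightarrow> bool" where
  "cstar_subalgebra A \<longleftrightarrow> A \<subseteq> bounded_ops \<and> 0 \<in> A \<and>
     (\<forall>a\<in>A. \<forall>b\<in>A. a + b \<in> A) \<and> (\<forall>c. \<forall>a\<in>A. scaleC_op c a \<in> A) \<and>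
     (\<forall>a\<in>A. \<forall>b\<in>A. a o\<^sub>L b \<in> A) \<and> (\<forall>a\<in>A. adj a \<in> A) \<and> closed A"

definition commutative_ops :: "('h::complex_hilbert_space \<Rightarrow>\<^sub>L 'h) set \<Rightarrow> bool" where
  "commutative_ops A \<longleftrightarrow> (\<forall>a\<in>A. \<forall>b\<in>A. a o\<^sub>L b = b o\<^sub>L a)"

definition cstar_generated :: "('h::complex_hilbert_space \<Rightarrow>\<^sub>L 'h) set \<Rightarrow> ('h \<Rightarrow>\<^sub>L 'h) set" where
  "cstar_generated S = \<Inter>{B. cstar_subalgebra B \<and> S \<subseteq> B}"

definition star_endomorphism ::
    "('h::complex_hilbert_space \<Rightarrow>\<^sub>L 'h) set \<Rightarrow> (('h \<Rightarrow>\<^sub>L 'h) \<Rightarrow> ('h \<Rightarrow>\<^sub>L 'h)) \<Rightarrow> bool" where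
  "star_endomorphism A d \<longleftrightarrow> (\<forall>a\<in>A. d a \<in> A) \<and>
     (\<forall>a\<in>A. \<forall>b\<in>A. d (a + b) = d a + d b) \<and> (\<forall>c. \<forall>a\<in>A. d (scaleC_op c a) = scaleC_op c (d a)) \<and>
     (\<forall>a\<in>A. \<forall>b\<in>A. d (a o\<^sub>L b) = d a o\<^sub>L d b) \<and> (\<forall>a\<in>A. d (adj a) = adj (d a))"

text \<open>
  Functionals on an algebra \<open>B\<close> of operators are functions with the default value outside \<open>B\<close>
  (\<^term>\<open>extensional B\<close>), so that their equality is equality on \<open>B\<close>. Below,
  \<open>max_ideal_space B\<close> is the underlying set of \<open>M(B)\<close>.
\<close>

type_synonym 'h functional = "('h \<Rightarrow>\<^sub>L 'h) \<Rightarrow> complex"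

definition max_ideal_space ::
    "('h::complex_hilbert_space \<Rightarrow>\<^sub>L 'h) set \<Rightarrow> 'h functional set" where
  "max_ideal_space B = {\<phi> \<in> extensional B.
     (\<forall>a\<in>B. \<forall>b\<in>B. \<phi> (a + b) = \<phi> a + \<phi> b) \<and> (\<forall>c. \<forall>a\<in>B. \<phi> (scaleC_op c a) = c * \<phi> a) \<and>
     (\<forall>a\<in>B. \<forall>b\<in>B. \<phi> (a o\<^sub>L b) = \<phi> a * \<phi> b) \<and> (\<exists>a\<in>B. \<phi> a \<noteq> 0)}"

definition zero_functional ::
    "('h::complex_hilbert_space \<Rightarrow>\<^sub>L 'h) set \<Rightarrow> 'h functional" where
  "zero_functional B = (\<lambda>a\<in>B. 0)"


section \<open>The partial mapping and the coefficient algebra\<close>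

definition delta :: "('h::complex_hilbert_space \<Rightarrow>\<^sub>L 'h) \<Rightarrow> ('h \<Rightarrow>\<^sub>L 'h) \<Rightarrow> ('h \<Rightarrow>\<^sub>L 'h)" where
  "delta U a = U o\<^sub>L a o\<^sub>L adj U"

definition delta_star :: "('h::complex_hilbert_space \<Rightarrow>\<^sub>L 'h) \<Rightarrow> ('h \<Rightarrow>\<^sub>L 'h) \<Rightarrow> ('h \<Rightarrow>\<^sub>L 'h)" where
  "delta_star U x = adj U o\<^sub>L x o\<^sub>L U"

definition Delta ::
    "('h::complex_hilbert_space \<Rightarrow>\<^sub>L 'h) set \<Rightarrow> ('h \<Rightarrow>\<^sub>L 'h) \<Rightarrow> 'h functional set" where
  "Delta A U = {\<tau> \<in> max_ideal_space A. \<tau> (U o\<^sub>L adj U) = 1}"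

text \<open>The partial mapping is \<open>alpha A U\<close> on \<open>Delta A U\<close>; its values elsewhere carry no meaning.\<close>

definition alpha ::
    "('h::complex_hilbert_space \<Rightarrow>\<^sub>L 'h) set \<Rightarrow> ('h \<Rightarrow>\<^sub>L 'h) \<Rightarrow> 'h functional \<Rightarrow> 'h functional" where
  "alpha A U \<tau> = (\<lambda>a\<in>A. \<tau> (delta U a))"

text \<open>
  \<open>Delta_dom A U n\<close> is \<open>\<Delta>\<^sub>n\<close>, the domain of the \<open>n\<close>-th iterate of the partial mapping, and
  \<open>Delta_img A U n\<close> is \<open>\<Delta>\<^bsub>-n\<^esub>\<close>, the image of that iterate.
\<close>

definition Delta_dom ::
    "('h::complex_hilbert_space \<Rightarrow>\<^sub>L 'h) set \<Rightarrow> ('h \<Rightarrow>\<^sub>L 'h) \<Rightarrow> nat \<Rightarrow> 'h functional set" where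
  "Delta_dom A U n = {\<tau> \<in> max_ideal_space A. \<forall>k<n. (alpha A U ^^ k) \<tau> \<in> Delta A U}"

definition Delta_img ::
    "('h::complex_hilbert_space \<Rightarrow>\<^sub>L 'h) set \<Rightarrow> ('h \<Rightarrow>\<^sub>L 'h) \<Rightarrow> nat \<Rightarrow> 'h functional set" where
  "Delta_img A U n = (alpha A U ^^ n) ` Delta_dom A U n"

lemma Delta_dom_0: "Delta_dom A U 0 = max_ideal_space A"
  by (simp add: Delta_dom_def)

lemma Delta_dom_1: "Delta_dom A U 1 = Delta A U"
  by (auto simp: Delta_dom_def Delta_def)

lemma Delta_img_1: "Delta_img A U 1 = alpha A U ` Delta A U"
  unfolding Delta_img_def Delta_dom_1 by simp

definition coefficient_algebra ::
    "('h::complex_hilbert_space \<Rightarrow>\<^sub>L 'h) set \<Rightarrow> ('h \<Rightarrow>\<^sub>L 'h) \<Rightarrow> ('h \<Rightarrow>\<^sub>L 'h) set" where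
  "coefficient_algebra A U = cstar_generated (\<Union>n. (delta_star U ^^ n) ` A)"

definition xi ::
    "('h::complex_hilbert_space \<Rightarrow>\<^sub>L 'h) set \<Rightarrow> ('h \<Rightarrow>\<^sub>L 'h) \<Rightarrow> 'h functional \<Rightarrow> nat \<Rightarrow> 'h functional" where
  "xi A U x n = (\<lambda>a\<in>A. x ((delta_star U ^^ n) a))"

text \<open>
  In both definitions the conditions force each \<open>s n\<close> with \<open>\<alpha>(s n) = s (n - 1)\<close> to lie in \<open>\<Delta>\<close>, and
  the nonzero entries to lie in \<open>M(A)\<close>.
\<close>

definition M_hat ::
    "('h::complex_hilbert_space \<Rightarrow>\<^sub>L 'h) set \<Rightarrow> ('h \<Rightarrow>\<^sub>L 'h) \<Rightarrow> nat \<Rightarrow> (nat \<Rightarrow> 'h functional) set" where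
  "M_hat A U N = {s. s N \<in> Delta_dom A U N \<and> s N \<notin> Delta_img A U 1 \<and>
     (\<forall>n. 1 \<le> n \<and> n \<le> N \<longrightarrow> alpha A U (s n) = s (n - 1)) \<and> (\<forall>n>N. s n = zero_functional A)}"

definition M_infty ::
    "('h::complex_hilbert_space \<Rightarrow>\<^sub>L 'h) set \<Rightarrow> ('h \<Rightarrow>\<^sub>L 'h) \<Rightarrow> (nat \<Rightarrow> 'h functional) set" where
  "M_infty A U = {s. (\<forall>n. s n \<in> Delta_dom A U n) \<and> (\<forall>n\<ge>1. alpha A U (s n) = s (n - 1))}"

end

theory Submission
  imports Defs
begin

text \<open>
  The proof never represents an algebra as functions on its maximal ideal space. It works with
  vectors of \<open>H\<close> instead: a character \<open>\<phi>\<close> of a commutative operator algebra is governed by the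
  vectors that are almost joint eigenvectors, \<open>T v \<approx> \<phi>(T) v\<close>. A family \<open>J\<close> of operators is called
  jointly singular if no inequality \<open>\<parallel>v\<parallel>\<^sup>2 \<le> C (\<parallel>T\<^sub>1 v\<parallel>\<^sup>2 + \<dots> + \<parallel>T\<^sub>m v\<parallel>\<^sup>2)\<close> with \<open>T\<^sub>i \<in> J\<close> holds
  for all \<open>v\<close>, i.e. if there are unit vectors on which any finitely many members of \<open>J\<close> are
  simultaneously as small as desired. Two facts link this notion with characters.

  \<^item> The kernel of a character is jointly singular (\<open>kernel_jointly_singular\<close>).
  \<^item> A jointly singular subset of a commutative unital C*-algebra is annihilated by some
    character of that algebra (\<open>character_annihilating\<close>).

  Let now \<open>s = (x\<^sub>0, x\<^sub>1, \<dots>)\<close> be one of the given sequences. By the second fact it suffices that the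
  operators \<open>\<delta>\<^sub>*\<^sup>k(a) - x\<^sub>k(a)\<close>, for \<open>k \<ge> 0\<close> and \<open>a \<in> A\<close>, form a jointly singular family. Fix \<open>n\<close> with
  \<open>x\<^sub>n \<in> \<Delta>\<^sub>n\<close> and take a vector \<open>v\<close> on which the operators in the kernel of \<open>x\<^sub>n\<close> are small. Since
  \<open>a U\<^sup>* = U\<^sup>* \<delta>(a)\<close> for \<open>a \<in> A\<close>, the vector \<open>U\<^sup>*\<^sup>n v\<close> satisfies
  \<open>\<delta>\<^sub>*\<^sup>k(a) U\<^sup>*\<^sup>n v = U\<^sup>*\<^sup>n \<delta>\<^sup>n\<^sup>-\<^sup>k(a) \<delta>\<^sup>n(1) v\<close> for \<open>k \<le> n\<close>, which is close to
  \<open>x\<^sub>n(\<delta>\<^sup>n\<^sup>-\<^sup>k(a)) U\<^sup>*\<^sup>n v = x\<^sub>k(a) U\<^sup>*\<^sup>n v\<close>; and \<open>U\<^sup>*\<^sup>n v\<close> is not small because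
  \<open>U\<^sup>n U\<^sup>*\<^sup>n v = \<delta>\<^sup>n(1) v \<approx> v\<close>. For a sequence in \<open>M\<^sub>\<infinity>\<close> this is all, as any finite part of the
  family involves only indices \<open>k\<close> below some \<open>n\<close>.

  For a sequence that ends at \<open>x\<^sub>N\<close> one takes \<open>n = N\<close> and must also make \<open>\<delta>\<^sub>*\<^sup>k(a) U\<^sup>*\<^sup>N v\<close> small for \<open>k > N\<close>,
  which follows once \<open>U v\<close> is small. This is where \<open>x\<^sub>N \<notin> \<alpha>(\<Delta>)\<close> enters (\<open>singular_off_image\<close>):
  were \<open>U v\<close> not small for some of these \<open>v\<close>, then \<open>U v\<close> would be an almost joint eigenvector for
  \<open>\<delta>(a)\<close> with eigenvalue \<open>x\<^sub>N(a)\<close>, and the second fact would give \<open>\<tau> \<in> \<Delta>\<close> with \<open>\<alpha>(\<tau>) = x\<^sub>N\<close>.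
\<close>

section \<open>The inner product\<close>

lemma cinner_add_right: "cinner x (y + z) = cinner x y + cinner (x :: 'h::complex_hilbert_space) z"
  by (metis cinner_add_left cinner_commute complex_cnj_add)

lemma cinner_scaleC_right: "cinner x (c *\<^sub>C y) = cnj c * cinner (x :: 'h::complex_hilbert_space) y"
  by (metis cinner_commute cinner_scaleC_left complex_cnj_mult)

lemma cinner_zero_left [simp]: "cinner 0 (y :: 'h::complex_hilbert_space) = 0"
  using cinner_add_left[of 0 0 y] by simp

lemma cinner_zero_right [simp]: "cinner (x :: 'h::complex_hilbert_space) 0 = 0"
  using cinner_add_right[of x 0 0] by simp

lemma cinner_minus_left: "cinner (- x) y = - cinner (x :: 'h::complex_hilbert_space) y"
  using cinner_add_left[of "- x" x y] by (simp add: eq_neg_iff_add_eq_0)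

lemma cinner_minus_right: "cinner x (- y) = - cinner (x :: 'h::complex_hilbert_space) y"
  using cinner_add_right[of x "- y" y] by (simp add: eq_neg_iff_add_eq_0)

lemma cinner_diff_left: "cinner (x - y) z = cinner x z - cinner (y :: 'h::complex_hilbert_space) z"
  using cinner_add_left[of x "- y" z] by (simp add: cinner_minus_left)

lemma cinner_diff_right: "cinner x (y - z) = cinner x y - cinner (x :: 'h::complex_hilbert_space) z"
  using cinner_add_right[of x y "- z"] by (simp add: cinner_minus_right)

lemma scaleC_one [simp]: "1 *\<^sub>C x = (x :: 'h::complex_hilbert_space)"
  using scaleC_of_real[of 1 x] by simp

lemma scaleC_zero_left [simp]: "0 *\<^sub>C x = (0 :: 'h::complex_hilbert_space)"
  using scaleC_of_real[of 0 x] by simp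

lemma scaleC_minus_one: "(- 1) *\<^sub>C x = - (x :: 'h::complex_hilbert_space)"
  using scaleC_of_real[of "-1" x] by simp

lemma scaleC_minus_left: "(- c) *\<^sub>C x = - (c *\<^sub>C (x :: 'h::complex_hilbert_space))"
  using scaleC_add_left[of "- c" c x] by (simp add: eq_neg_iff_add_eq_0)

lemma scaleC_diff_right: "c *\<^sub>C (x - y) = c *\<^sub>C x - c *\<^sub>C (y :: 'h::complex_hilbert_space)"
  using scaleC_add_right[of c "x - y" y] by simp

lemma norm_add_sq:
  "(norm (x + y))\<^sup>2 = (norm x)\<^sup>2 + 2 * Re (cinner x y) + (norm (y :: 'h::complex_hilbert_space))\<^sup>2"
proof -
  have "complex_of_real ((norm (x + y))\<^sup>2)
      = cinner x x + (cinner x y + cnj (cinner x y)) + cinner y y"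
    by (simp only: cinner_self[symmetric] cinner_add_left cinner_add_right cinner_commute[of y x]
        ac_simps)
  then have "complex_of_real ((norm (x + y))\<^sup>2)
      = complex_of_real ((norm x)\<^sup>2 + 2 * Re (cinner x y) + (norm y)\<^sup>2)"
    by (simp add: cinner_self complex_add_cnj)
  then show ?thesis
    using of_real_eq_iff by blast
qed

lemma norm_diff_sq:
  "(norm (x - y))\<^sup>2 = (norm x)\<^sup>2 - 2 * Re (cinner x y) + (norm (y :: 'h::complex_hilbert_space))\<^sup>2"
  using norm_add_sq[of x "- y"] by (simp add: cinner_minus_right)

lemma norm_cinner_le: "cmod (cinner x y) \<le> norm x * norm (y :: 'h::complex_hilbert_space)"
proof (cases "y = 0")
  case False
  define c where "c = cinner x y / complex_of_real ((norm y)\<^sup>2)"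
  have "Re (cinner x (c *\<^sub>C y)) = (cmod (cinner x y))\<^sup>2 / (norm y)\<^sup>2"
    by (simp add: cinner_scaleC_right c_def complex_norm_square[symmetric] mult.commute
        flip: of_real_divide of_real_power)
  moreover have "(norm (c *\<^sub>C y))\<^sup>2 = (cmod (cinner x y))\<^sup>2 / (norm y)\<^sup>2"
    using False by (simp add: norm_scaleC c_def norm_divide power2_eq_square norm_mult)
  ultimately have "0 \<le> (norm x)\<^sup>2 - (cmod (cinner x y))\<^sup>2 / (norm y)\<^sup>2"
    using norm_diff_sq[of x "c *\<^sub>C y"] zero_le_power2[of "norm (x - c *\<^sub>C y)"] by linarith
  then have "(cmod (cinner x y))\<^sup>2 \<le> (norm x * norm y)\<^sup>2"
    using False by (simp add: field_simps power_mult_distrib)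
  then show ?thesis
    by (rule power2_le_imp_le) simp
qed simp

lemma cinner_eqI:
  assumes "\<And>x. cinner x y = cinner x (z :: 'h::complex_hilbert_space)"
  shows "y = z"
proof -
  have "cinner (y - z) (y - z) = 0"
    using assms[of "y - z"] by (simp add: cinner_diff_right)
  then show ?thesis
    by (simp add: cinner_self)
qed

section \<open>The Riesz representation theorem and adjoints\<close>

text \<open>
  The representing vector minimizes \<open>J(x) = \<parallel>x\<parallel>\<^sup>2 - 2 Re f(x)\<close>. By the parallelogram law a minimizing
  sequence is Cauchy, and at a minimum \<open>z\<close> the first variation \<open>\<langle>x,z\<rangle> - f(x)\<close> vanishes.
\<close>

lemma riesz_representation:
  fixes f :: "'h::complex_hilbert_space \<Rightarrow> complex"
  assumes add: "\<And>x y. f (x + y) = f x + f y" and scale: "\<And>c x. f (c *\<^sub>C x) = c * f x"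
    and bound: "\<And>x. cmod (f x) \<le> K * norm x"
  shows "\<exists>z. \<forall>x. f x = cinner x z"
proof -
  define J where "J x = (norm x)\<^sup>2 - 2 * Re (f x)" for x
  have lin: "bounded_linear f"
  proof (rule bounded_linear_intro[where K = K])
    show "f (r *\<^sub>R x) = r *\<^sub>R f x" for r x
      using scale[of "complex_of_real r" x] by (simp add: scaleC_of_real scaleR_conv_of_real)
  qed (use add bound in \<open>simp_all add: mult.commute\<close>)
  have "- K\<^sup>2 \<le> J x" for x
  proof -
    have "Re (f x) \<le> K * norm x"
      using bound[of x] complex_Re_le_cmod[of "f x"] by linarith
    moreover have "0 \<le> (norm x - K)\<^sup>2"
      by simp
    ultimately show ?thesis
      unfolding J_def by (simp add: power2_diff mult_ac)
  qed
  then have bdd: "bdd_below (range J)"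
    by (auto intro!: bdd_belowI)
  define m where "m = Inf (range J)"
  have m_le: "m \<le> J x" for x
    unfolding m_def by (rule cInf_lower) (use bdd in auto)
  have "\<exists>x. J x < m + inverse (real (Suc n))" for n
    using cInf_lessD[of "range J" "m + inverse (real (Suc n))"] by (auto simp: m_def)
  then obtain X where X: "\<And>n. J (X n) < m + inverse (real (Suc n))"
    by metis
  have half: "(norm (x - y))\<^sup>2 \<le> 2 * J x + 2 * J y - 4 * m" for x y
  proof -
    have mid: "f ((1/2) *\<^sub>R (x + y)) = (1/2) * (f x + f y)"
      by (simp only: linear_scale[OF bounded_linear.linear[OF lin]] add) (simp add: scaleR_conv_of_real)
    have "4 * J ((1/2) *\<^sub>R (x + y)) = (norm (x + y))\<^sup>2 - 4 * Re (f x) - 4 * Re (f y)"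
      unfolding J_def mid norm_scaleR by (simp add: power_divide field_simps)
    then have "(norm (x - y))\<^sup>2 = 2 * J x + 2 * J y - 4 * J ((1/2) *\<^sub>R (x + y))"
      by (simp add: J_def norm_diff_sq norm_add_sq)
    moreover have "4 * m \<le> 4 * J ((1/2) *\<^sub>R (x + y))"
      using m_le[of "(1/2) *\<^sub>R (x + y)"] by simp
    ultimately show ?thesis
      by linarith
  qed
  have "Cauchy X"
  proof (rule metric_CauchyI)
    fix e :: real
    assume "0 < e"
    then obtain N where N: "inverse (real (Suc N)) < e\<^sup>2 / 4"
      using reals_Archimedean[of "e\<^sup>2 / 4"] by auto
    have small: "4 * J (X n) < 4 * m + e\<^sup>2" if "N \<le> n" for n
    proof -
      have "inverse (real (Suc n)) \<le> inverse (real (Suc N))"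
        using that by simp
      then show ?thesis
        using X[of n] N by linarith
    qed
    have "dist (X p) (X q) < e" if "N \<le> p" "N \<le> q" for p q
    proof -
      have "(norm (X p - X q))\<^sup>2 < e\<^sup>2"
        using half[of "X p" "X q"] small[OF that(1)] small[OF that(2)] by linarith
      then show ?thesis
        using \<open>0 < e\<close> by (simp add: dist_norm power_less_imp_less_base)
    qed
    then show "\<exists>M. \<forall>p\<ge>M. \<forall>q\<ge>M. dist (X p) (X q) < e"
      by blast
  qed
  then obtain z where z: "X \<longlonglongrightarrow> z"
    by (auto simp: Cauchy_convergent_iff convergent_def)
  have "(\<lambda>n. J (X n)) \<longlonglongrightarrow> J z"
    unfolding J_def by (intro tendsto_intros z bounded_linear.tendsto[OF lin])
  moreover have "(\<lambda>n. m + inverse (real (Suc n))) \<longlonglongrightarrow> m + 0"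
    by (intro tendsto_intros LIMSEQ_inverse_real_of_nat)
  ultimately have "J z \<le> m"
    using LIMSEQ_le[of "\<lambda>n. J (X n)" "J z" "\<lambda>n. m + inverse (real (Suc n))" "m + 0"] X
    by (auto intro: less_imp_le)
  define g where "g x = cinner x z - f x" for x
  have pos: "0 \<le> (norm x)\<^sup>2 + 2 * Re (g x)" for x
    using m_le[of "x + z"] \<open>J z \<le> m\<close> norm_add_sq[of x z] by (simp add: J_def g_def add)
  have "g x = 0" for x
  proof (rule ccontr)
    assume "g x \<noteq> 0"
    \<comment> \<open>Moving from the minimum in the direction of \<open>x\<close>, rotated by a phase so that the linear
      term is negative; \<open>t\<close> is so small that the quadratic term cannot compensate.\<close>
    define t where "t = inverse ((norm x)\<^sup>2 + 1)"
    have t: "0 < t" "t * (norm x)\<^sup>2 < 1"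
      by (auto simp: t_def field_simps add_pos_nonneg)
    define c where "c = - (complex_of_real t * cnj (g x))"
    have "g (c *\<^sub>C x) = c * g x"
      by (simp add: g_def scale cinner_scaleC_left algebra_simps)
    also have "\<dots> = - complex_of_real (t * (cmod (g x))\<^sup>2)"
      by (simp only: c_def of_real_mult complex_norm_square) (simp add: mult_ac)
    finally have "Re (g (c *\<^sub>C x)) = - (t * (cmod (g x))\<^sup>2)"
      by simp
    moreover have "(norm (c *\<^sub>C x))\<^sup>2 = t * (cmod (g x))\<^sup>2 * (t * (norm x)\<^sup>2)"
      using t by (simp add: norm_scaleC c_def norm_mult power2_eq_square)
    ultimately have "0 \<le> (t * (cmod (g x))\<^sup>2) * (t * (norm x)\<^sup>2 - 2)"
      using pos[of "c *\<^sub>C x"] by (simp add: algebra_simps)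
    moreover have "0 < t * (cmod (g x))\<^sup>2"
      using t \<open>g x \<noteq> 0\<close> by simp
    ultimately show False
      using t by (simp add: zero_le_mult_iff)
  qed
  then show ?thesis
    by (intro exI[of _ z]) (simp add: g_def)
qed

lemma bounded_opsD: "T \<in> bounded_ops \<Longrightarrow> blinfun_apply T (c *\<^sub>C x) = c *\<^sub>C blinfun_apply T x"
  by (simp add: bounded_ops_def)

lemma adjoint_exists:
  fixes T :: "'h::complex_hilbert_space \<Rightarrow>\<^sub>L 'h"
  assumes "T \<in> bounded_ops"
  shows "\<exists>S\<in>bounded_ops. \<forall>x y. cinner (blinfun_apply T x) y = cinner x (blinfun_apply S y)"
proof -
  have "\<exists>z. \<forall>x. cinner (blinfun_apply T x) y = cinner x z" for y
  proof (rule riesz_representation)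
    show "cmod (cinner (blinfun_apply T x) y) \<le> (norm T * norm y) * norm x" for x
    proof -
      have "cmod (cinner (blinfun_apply T x) y) \<le> norm (blinfun_apply T x) * norm y"
        by (rule norm_cinner_le)
      also have "\<dots> \<le> (norm T * norm x) * norm y"
        by (intro mult_right_mono norm_blinfun) simp
      finally show ?thesis
        by (simp add: mult_ac)
    qed
  qed (simp_all add: blinfun.add_right cinner_add_left cinner_scaleC_left bounded_opsD[OF assms])
  then obtain S where S: "\<And>x y. cinner (blinfun_apply T x) y = cinner x (S y)"
    by metis
  have add: "S (x + y) = S x + S y" for x y
    by (rule cinner_eqI) (simp add: S[symmetric] cinner_add_right)
  have scale: "S (c *\<^sub>C x) = c *\<^sub>C S x" for c x
    by (rule cinner_eqI) (simp add: S[symmetric] cinner_scaleC_right)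
  have bound: "norm (S y) \<le> norm y * norm T" for y
  proof (cases "S y = 0")
    case False
    have "complex_of_real ((norm (S y))\<^sup>2) = cinner (blinfun_apply T (S y)) y"
      by (simp add: S cinner_self)
    then have "(norm (S y))\<^sup>2 = cmod (cinner (blinfun_apply T (S y)) y)"
      by (metis norm_of_real abs_power2)
    also have "\<dots> \<le> norm (blinfun_apply T (S y)) * norm y"
      by (rule norm_cinner_le)
    also have "\<dots> \<le> (norm T * norm (S y)) * norm y"
      by (intro mult_right_mono norm_blinfun) simp
    finally have "norm (S y) * norm (S y) \<le> norm (S y) * (norm y * norm T)"
      by (simp add: power2_eq_square mult_ac)
    then show ?thesis
      using False by simp
  qed simp
  have "bounded_linear S"
  proof (rule bounded_linear_intro[OF add _ bound])
    show "S (r *\<^sub>R x) = r *\<^sub>R S x" for r x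
      using scale[of "complex_of_real r" x] by (simp only: scaleC_of_real)
  qed
  then have "blinfun_apply (Blinfun S) = S"
    by (rule bounded_linear_Blinfun_apply)
  then show ?thesis
    using S scale by (intro bexI[of _ "Blinfun S"]) (auto simp: bounded_ops_def)
qed

text \<open>
  Uniqueness of the adjoint, the other half of what the definite description in \<^const>\<open>adj\<close> needs.
\<close>

lemma adj_eqI:
  fixes T :: "'h::complex_hilbert_space \<Rightarrow>\<^sub>L 'h"
  assumes "S \<in> bounded_ops" "\<And>x y. cinner (blinfun_apply T x) y = cinner x (blinfun_apply S y)"
  shows "adj T = S"
  unfolding adj_def
proof (rule the_equality)
  fix S'
  assume "S' \<in> bounded_ops \<and> (\<forall>x y. cinner (blinfun_apply T x) y = cinner x (blinfun_apply S' y))"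
  then have "cinner x (blinfun_apply S' y) = cinner x (blinfun_apply S y)" for x y
    using assms(2)[of x y] by simp
  then show "S' = S"
    by (intro blinfun_eqI, rule cinner_eqI)
qed (use assms in blast)

lemma
  assumes "T \<in> bounded_ops"
  shows adj_bounded_ops: "adj T \<in> bounded_ops"
    and cinner_adj_right: "cinner x (blinfun_apply (adj T) y) = cinner (blinfun_apply T x) y"
proof -
  obtain S where S: "S \<in> bounded_ops"
      "\<And>x y. cinner (blinfun_apply T x) y = cinner x (blinfun_apply S y)"
    using adjoint_exists[OF assms] by blast
  then have "adj T = S"
    by (rule adj_eqI)
  with S show "adj T \<in> bounded_ops"
    "cinner x (blinfun_apply (adj T) y) = cinner (blinfun_apply T x) y"
    by simp_all
qed

lemma cinner_adj_left:
  "T \<in> bounded_ops \<Longrightarrow> cinner (blinfun_apply (adj T) x) y = cinner x (blinfun_apply T y)"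
  by (subst (1 2) cinner_commute) (simp add: cinner_adj_right)

lemma adj_adj: "T \<in> bounded_ops \<Longrightarrow> adj (adj T) = T"
  by (rule adj_eqI) (simp_all add: cinner_adj_left)

lemma id_bounded_ops [simp]: "id_blinfun \<in> bounded_ops"
  by (simp add: bounded_ops_def)

lemma add_bounded_ops: "S \<in> bounded_ops \<Longrightarrow> T \<in> bounded_ops \<Longrightarrow> S + T \<in> bounded_ops"
  by (simp add: bounded_ops_def blinfun.add_left scaleC_add_right)

lemma scaleC_op_bounded_ops: "T \<in> bounded_ops \<Longrightarrow> scaleC_op c T \<in> bounded_ops"
  by (simp add: bounded_ops_def scaleC_op.rep_eq scaleC_scaleC mult.commute)

lemma compose_bounded_ops: "S \<in> bounded_ops \<Longrightarrow> T \<in> bounded_ops \<Longrightarrow> S o\<^sub>L T \<in> bounded_ops"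
  by (simp add: bounded_ops_def)

lemma adj_compose:
  "S \<in> bounded_ops \<Longrightarrow> T \<in> bounded_ops \<Longrightarrow> adj (S o\<^sub>L T) = adj T o\<^sub>L adj S"
  by (rule adj_eqI) (simp_all add: compose_bounded_ops adj_bounded_ops cinner_adj_right)

lemma adj_id_plus_scale:
  "T \<in> bounded_ops \<Longrightarrow> adj (id_blinfun + scaleC_op c T) = id_blinfun + scaleC_op (cnj c) (adj T)"
  by (rule adj_eqI) (simp_all add: add_bounded_ops scaleC_op_bounded_ops adj_bounded_ops
      blinfun.add_left scaleC_op.rep_eq cinner_add_left cinner_add_right cinner_scaleC_left
      cinner_scaleC_right cinner_adj_right)

text \<open>
  The range of \<open>U\<^sup>*\<close> is orthogonal to the kernel of \<open>U\<close>, so \<open>U\<close> is isometric on it: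
  \<open>\<parallel>U U\<^sup>* x\<parallel> = \<parallel>U\<^sup>* x\<parallel>\<close>. Hence the quadratic form of \<open>(U U\<^sup>*)\<^sup>2 - U U\<^sup>*\<close> vanishes, and so does the operator
  by polarization.
\<close>

lemma partial_isometry_triple_product:
  fixes U :: "'h::complex_hilbert_space \<Rightarrow>\<^sub>L 'h"
  assumes "partial_isometry U"
  shows "U o\<^sub>L adj U o\<^sub>L U = U"
proof (rule blinfun_eqI)
  let ?u = "blinfun_apply U" and ?w = "blinfun_apply (adj U)"
  have U: "U \<in> bounded_ops"
    using assms by (simp add: partial_isometry_def)
  note cs = cinner_adj_left[OF U] cinner_adj_right[OF U]
  define D where "D x = ?u (?w (?u (?w x))) - ?u (?w x)" for x
  have D_add: "D (x + y) = D x + D y" for x y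
    by (simp add: D_def blinfun.add_right)
  have D_scale: "D (c *\<^sub>C x) = c *\<^sub>C D x" for c x
    by (simp add: D_def bounded_opsD U adj_bounded_ops[OF U] scaleC_diff_right)
  have D_form: "cinner (D x) x = 0" for x
  proof -
    have "norm (?u (?w x)) = norm (?w x)"
      using assms by (simp add: partial_isometry_def cs)
    then have "cinner (?u (?w x)) (?u (?w x)) = cinner (?w x) (?w x)"
      by (simp add: cinner_self)
    moreover have "cinner (D x) x = cinner (?u (?w x)) (?u (?w x)) - cinner (?w x) (?w x)"
      by (simp add: D_def cinner_diff_left flip: cinner_adj_left[OF U] cinner_adj_right[OF U])
    ultimately show ?thesis
      by simp
  qed
  have D0: "D x = 0" for x
  proof -
    \<comment> \<open>Polarization: the form vanishes at \<open>x + y\<close> and at \<open>x + \<i> y\<close>.\<close>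
    have p: "cinner (D x) y + cinner (D y) x = 0" for x y
      using D_form[of "x + y"] by (simp add: D_add cinner_add_left cinner_add_right D_form add.commute)
    have "cinner (D x) y = 0" for y
    proof -
      have "\<i> * cinner (D y) x - \<i> * cinner (D x) y = 0"
        using p[of x "\<i> *\<^sub>C y"] by (simp add: D_scale cinner_scaleC_left cinner_scaleC_right)
      then have "cinner (D y) x = cinner (D x) y"
        by (simp flip: right_diff_distrib)
      then show ?thesis
        using p[of x y] by simp
    qed
    from this[of "D x"] show ?thesis
      by (simp add: cinner_self)
  qed
  fix x
  have e: "?w (?u (?w y)) = ?w y" for y
  proof -
    define d where "d = ?w (?u (?w y)) - ?w y"
    have "?u d = 0"
      using D0[of y] by (simp add: d_def D_def blinfun.diff_right)
    moreover have "cinner d d = cinner (?u d) (?u (?w y)) - cinner (?u d) y"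
      by (subst (2) d_def) (simp add: cinner_diff_right cs)
    ultimately show ?thesis
      by (simp add: cinner_self d_def)
  qed
  have "cinner y (?u (?w (?u x))) = cinner y (?u x)" for y
  proof -
    have "cinner y (?u (?w (?u x))) = cinner (?w y) (?w (?u x))"
      by (rule cinner_adj_left[OF U, symmetric])
    also have "\<dots> = cinner (?w (?u (?w y))) x"
      by (simp only: cinner_adj_left[OF U] cinner_adj_right[OF U])
    also have "\<dots> = cinner y (?u x)"
      by (simp add: e cinner_adj_left[OF U])
    finally show ?thesis .
  qed
  then have "?u (?w (?u x)) = ?u x"
    by (rule cinner_eqI)
  then show "blinfun_apply (U o\<^sub>L adj U o\<^sub>L U) x = ?u x"
    by simp
qed

section \<open>Jointly singular families of operators\<close>

text \<open>
  Bounding by sums of squares, and not by sums of norms, keeps the inequalities quadratic in \<open>v\<close>, so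
  that inner products can be expanded in them. The relation behaves like a preorder on quadratic forms
  modulo the forms that \<open>J\<close> controls, which replaces all \<open>\<epsilon>\<close>-estimates with almost null vectors.
\<close>

definition dominated :: "('h::real_normed_vector \<Rightarrow>\<^sub>L 'h) set \<Rightarrow> ('h \<Rightarrow> real) \<Rightarrow> bool" where
  "dominated J q \<longleftrightarrow> (\<exists>F C. finite F \<and> F \<subseteq> J \<and> 0 \<le> C \<and>
     (\<forall>v. q v \<le> C * (\<Sum>T\<in>F. (norm (blinfun_apply T v))\<^sup>2)))"

definition jointly_singular :: "('h::real_normed_vector \<Rightarrow>\<^sub>L 'h) set \<Rightarrow> bool" where
  "jointly_singular J \<longleftrightarrow> \<not> dominated J (\<lambda>v. (norm v)\<^sup>2)"

lemma dominated_mono: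
  assumes "dominated J q" "\<And>v. p v \<le> q v"
  shows "dominated J p"
  using assms unfolding dominated_def by (meson order_trans)

lemma dominated_subset: "dominated J q \<Longrightarrow> J \<subseteq> J' \<Longrightarrow> dominated J' q"
  unfolding dominated_def by (meson order_trans)

lemma dominated_nonpos: "(\<And>v. q v \<le> 0) \<Longrightarrow> dominated J q"
  unfolding dominated_def by (intro exI[of _ "{}"] exI[of _ 0]) auto

lemma dominated_member: "T \<in> J \<Longrightarrow> dominated J (\<lambda>v. (norm (blinfun_apply T v))\<^sup>2)"
  unfolding dominated_def by (intro exI[of _ "{T}"] exI[of _ 1]) auto

lemma dominated_add:
  assumes "dominated J p" "dominated J q"
  shows "dominated J (\<lambda>v. p v + q v)"
proof -
  from assms obtain F C G D where
    F: "finite F" "F \<subseteq> J" "0 \<le> C" "\<And>v. p v \<le> C * (\<Sum>T\<in>F. (norm (blinfun_apply T v))\<^sup>2)" and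
    G: "finite G" "G \<subseteq> J" "0 \<le> D" "\<And>v. q v \<le> D * (\<Sum>T\<in>G. (norm (blinfun_apply T v))\<^sup>2)"
    unfolding dominated_def by blast
  let ?s = "\<lambda>H v. \<Sum>T\<in>H. (norm (blinfun_apply T v))\<^sup>2"
  have "p v + q v \<le> (C + D) * ?s (F \<union> G) v" for v
  proof -
    have "?s F v \<le> ?s (F \<union> G) v" "?s G v \<le> ?s (F \<union> G) v"
      using F G by (auto intro!: sum_mono2)
    then have "C * ?s F v \<le> C * ?s (F \<union> G) v" "D * ?s G v \<le> D * ?s (F \<union> G) v"
      using F G by (auto intro: mult_left_mono)
    then show ?thesis
      using F(4)[of v] G(4)[of v] by (simp add: distrib_right)
  qed
  then show ?thesis
    unfolding dominated_def using F G
    by (intro exI[of _ "F \<union> G"] exI[of _ "C + D"]) auto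
qed

lemma dominated_scale:
  assumes "dominated J q" "0 \<le> c"
  shows "dominated J (\<lambda>v. c * q v)"
proof -
  from assms(1) obtain F C where
    F: "finite F" "F \<subseteq> J" "0 \<le> C" "\<And>v. q v \<le> C * (\<Sum>T\<in>F. (norm (blinfun_apply T v))\<^sup>2)"
    unfolding dominated_def by blast
  have "c * q v \<le> (c * C) * (\<Sum>T\<in>F. (norm (blinfun_apply T v))\<^sup>2)" for v
    using mult_left_mono[OF F(4) assms(2), of v] by (simp add: mult.assoc)
  then show ?thesis
    unfolding dominated_def using F assms(2)
    by (intro exI[of _ F] exI[of _ "c * C"]) auto
qed

lemma dominated_sum:
  assumes "finite F" "\<And>i. i \<in> F \<Longrightarrow> dominated J (q i)"
  shows "dominated J (\<lambda>v. \<Sum>i\<in>F. q i v)"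
  using assms by (induction F rule: finite_induct) (auto intro: dominated_nonpos dominated_add)

text \<open>
  Substituting \<open>W v\<close> for \<open>v\<close>: with \<open>W\<close> the identity this is transitivity, with other \<open>W\<close> it moves
  estimates from one family of vectors to another.
\<close>

lemma dominated_transfer:
  assumes "dominated J' q" "\<And>T. T \<in> J' \<Longrightarrow> dominated J (\<lambda>v. (norm (blinfun_apply T (W v)))\<^sup>2)"
  shows "dominated J (\<lambda>v. q (W v))"
proof -
  from assms(1) obtain F C where
    F: "finite F" "F \<subseteq> J'" "0 \<le> C" "\<And>v. q v \<le> C * (\<Sum>T\<in>F. (norm (blinfun_apply T v))\<^sup>2)"
    unfolding dominated_def by blast
  have "dominated J (\<lambda>v. C * (\<Sum>T\<in>F. (norm (blinfun_apply T (W v)))\<^sup>2))"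
    using F assms(2) by (intro dominated_scale dominated_sum) auto
  then show ?thesis
    by (rule dominated_mono) (rule F(4))
qed

text \<open>
  Splitting off one operator with an explicit constant \<open>K\<close>; the bound \<open>1 \<le> K\<close> makes it safe to
  divide by \<open>K\<close>.
\<close>

lemma dominated_insert:
  assumes "dominated (insert S J) q"
  shows "\<exists>K\<ge>1. dominated J (\<lambda>v. q v - K * (norm (blinfun_apply S v))\<^sup>2)"
proof -
  from assms obtain F C where
    F: "finite F" "F \<subseteq> insert S J" "0 \<le> C" "\<And>v. q v \<le> C * (\<Sum>T\<in>F. (norm (blinfun_apply T v))\<^sup>2)"
    unfolding dominated_def by blast
  let ?s = "\<lambda>H v. \<Sum>T\<in>H. (norm (blinfun_apply T v))\<^sup>2"
  have "q v - (C + 1) * (norm (blinfun_apply S v))\<^sup>2 \<le> C * ?s (F - {S}) v" for v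
  proof -
    have "?s F v \<le> ?s (insert S (F - {S})) v"
      using F by (intro sum_mono2) auto
    also have "\<dots> = (norm (blinfun_apply S v))\<^sup>2 + ?s (F - {S}) v"
      using F by (subst sum.insert) auto
    finally have "C * ?s F v \<le> C * ((norm (blinfun_apply S v))\<^sup>2 + ?s (F - {S}) v)"
      using F(3) by (rule mult_left_mono)
    then show ?thesis
      using F(4)[of v] zero_le_power2[of "norm (blinfun_apply S v)"]
      by (simp only: distrib_left distrib_right mult_1)
  qed
  then show ?thesis
    unfolding dominated_def using F
    by (intro exI[of _ "C + 1"] conjI exI[of _ "F - {S}"] exI[of _ C]) auto
qed

lemma norm_add_sq_le: "(norm (x + y))\<^sup>2 \<le> 2 * (norm x)\<^sup>2 + 2 * (norm (y :: 'a::real_normed_vector))\<^sup>2"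
proof -
  have "(norm (x + y))\<^sup>2 \<le> (norm x + norm y)\<^sup>2"
    by (intro power_mono norm_triangle_ineq) simp
  also have "\<dots> \<le> 2 * (norm x)\<^sup>2 + 2 * (norm y)\<^sup>2"
    using zero_le_power2[of "norm x - norm y"] by (simp add: power2_sum power2_diff)
  finally show ?thesis .
qed

lemma dominated_norm_add:
  assumes "dominated J (\<lambda>v. (norm (f v))\<^sup>2)" "dominated J (\<lambda>v. (norm (g v))\<^sup>2)"
  shows "dominated J (\<lambda>v. (norm (f v + g v))\<^sup>2)"
proof (rule dominated_mono)
  show "dominated J (\<lambda>v. 2 * (norm (f v))\<^sup>2 + 2 * (norm (g v))\<^sup>2)"
    by (intro dominated_add dominated_scale assms) auto
qed (rule norm_add_sq_le)

lemma dominated_norm_bound: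
  assumes "dominated J (\<lambda>v. (norm (f v))\<^sup>2)" "\<And>v. norm (g v) \<le> K * norm (f v)"
  shows "dominated J (\<lambda>v. (norm (g v))\<^sup>2)"
proof (rule dominated_mono)
  show "dominated J (\<lambda>v. K\<^sup>2 * (norm (f v))\<^sup>2)"
    by (intro dominated_scale assms) auto
  show "(norm (g v))\<^sup>2 \<le> K\<^sup>2 * (norm (f v))\<^sup>2" for v
    using power_mono[OF assms(2), of v 2] by (simp add: power_mult_distrib)
qed

text \<open>
  Joint singularity is a property of finite character. This makes Zorn's lemma applicable to it, and it
  lets the auxiliary index depend on the finite part under consideration.
\<close>

lemma jointly_singular_finite:
  assumes "\<And>F. finite F \<Longrightarrow> F \<subseteq> J \<Longrightarrow> jointly_singular F"
  shows "jointly_singular J"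
  using assms unfolding jointly_singular_def dominated_def by (meson order_refl)

lemma jointly_singular_subset: "jointly_singular J \<Longrightarrow> I \<subseteq> J \<Longrightarrow> jointly_singular I"
  unfolding jointly_singular_def using dominated_subset by blast

text \<open>
  If vectors \<open>v\<close> on which \<open>J\<close> is small are mapped by \<open>W\<close> to vectors on which \<open>J'\<close> is small, and \<open>W v\<close>
  is not negligible compared to \<open>v\<close>, then \<open>J'\<close> inherits joint singularity. The map \<open>W\<close> is arbitrary.
\<close>

lemma jointly_singular_transfer:
  assumes "jointly_singular J"
    and "\<And>T. T \<in> J' \<Longrightarrow> dominated J (\<lambda>v. (norm (blinfun_apply T (W v)))\<^sup>2)"
    and "dominated J (\<lambda>v. (norm v)\<^sup>2 - K * (norm (W v))\<^sup>2)" "0 \<le> K"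
  shows "jointly_singular J'"
  unfolding jointly_singular_def
proof
  assume "dominated J' (\<lambda>v. (norm v)\<^sup>2)"
  then have "dominated J (\<lambda>v. (norm (W v))\<^sup>2)"
    using assms(2) by (rule dominated_transfer)
  then have "dominated J (\<lambda>v. K * (norm (W v))\<^sup>2 + ((norm v)\<^sup>2 - K * (norm (W v))\<^sup>2))"
    by (intro dominated_add dominated_scale assms)
  then show False
    using assms(1) by (simp add: jointly_singular_def)
qed

section \<open>Characters of operator algebras\<close>

lemma cstar_subalgebra_mem:
  assumes "cstar_subalgebra A"
  shows "a \<in> A \<Longrightarrow> a \<in> bounded_ops" "0 \<in> A" "a \<in> A \<Longrightarrow> b \<in> A \<Longrightarrow> a + b \<in> A"
    "a \<in> A \<Longrightarrow> scaleC_op c a \<in> A" "a \<in> A \<Longrightarrow> b \<in> A \<Longrightarrow> a o\<^sub>L b \<in> A"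
    "a \<in> A \<Longrightarrow> adj a \<in> A" "closed A"
  using assms by (auto simp: cstar_subalgebra_def)

lemma diff_eq_add_scaleC_op: "a - b = a + scaleC_op (- 1) b"
  by (rule blinfun_eqI) (simp add: blinfun.diff_left blinfun.add_left scaleC_op.rep_eq scaleC_minus_one)

lemma cstar_subalgebra_diff:
  "cstar_subalgebra A \<Longrightarrow> a \<in> A \<Longrightarrow> b \<in> A \<Longrightarrow> a - b \<in> A"
  unfolding diff_eq_add_scaleC_op by (intro cstar_subalgebra_mem)

lemma character_apply:
  assumes "\<sigma> \<in> max_ideal_space A"
  shows "a \<in> A \<Longrightarrow> b \<in> A \<Longrightarrow> \<sigma> (a + b) = \<sigma> a + \<sigma> b" "a \<in> A \<Longrightarrow> \<sigma> (scaleC_op c a) = c * \<sigma> a"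
    "a \<in> A \<Longrightarrow> b \<in> A \<Longrightarrow> \<sigma> (a o\<^sub>L b) = \<sigma> a * \<sigma> b" "\<sigma> \<in> extensional A"
  using assms by (auto simp: max_ideal_space_def)

lemma character_diff:
  assumes "cstar_subalgebra A" "\<sigma> \<in> max_ideal_space A" "a \<in> A" "b \<in> A"
  shows "\<sigma> (a - b) = \<sigma> a - \<sigma> b"
  unfolding diff_eq_add_scaleC_op
  by (simp add: character_apply[OF assms(2)] cstar_subalgebra_mem[OF assms(1)] assms)

lemma character_zero:
  assumes "cstar_subalgebra A" "\<sigma> \<in> max_ideal_space A"
  shows "\<sigma> 0 = 0"
  using character_apply(1)[OF assms(2), of 0 0] cstar_subalgebra_mem(2)[OF assms(1)] by simp

lemma character_id:
  assumes "\<sigma> \<in> max_ideal_space A" "id_blinfun \<in> A"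
  shows "\<sigma> id_blinfun = 1"
proof -
  obtain a where a: "a \<in> A" "\<sigma> a \<noteq> 0"
    using assms(1) by (auto simp: max_ideal_space_def)
  have "a o\<^sub>L id_blinfun = a"
    by (rule blinfun_eqI) simp
  then have "\<sigma> a = \<sigma> a * \<sigma> id_blinfun"
    using character_apply(3)[OF assms(1) a(1) assms(2)] by simp
  then show ?thesis
    using a(2) by simp
qed

text \<open>
  The fixed point \<open>y = b + b y\<close>, in other words the geometric series \<open>b + b\<^sup>2 + \<dots>\<close>, would satisfy
  \<open>\<sigma>(y) = 1 + \<sigma>(y)\<close>. This is the automatic contractivity of characters in the form used below.
\<close>

lemma character_contraction_neq_1:
  assumes A: "cstar_subalgebra A" and \<sigma>: "\<sigma> \<in> max_ideal_space A"
    and b: "b \<in> A" "norm b < 1"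
  shows "\<sigma> b \<noteq> 1"
proof
  assume "\<sigma> b = 1"
  have "\<exists>!y\<in>A. b + (b o\<^sub>L y) = y"
  proof (rule Banach_fix)
    show "complete A"
      using cstar_subalgebra_mem(7)[OF A] by (simp add: complete_eq_closed)
    show "A \<noteq> {}" "(\<lambda>y. b + (b o\<^sub>L y)) ` A \<subseteq> A"
      using b cstar_subalgebra_mem[OF A] by auto
    show "dist (b + (b o\<^sub>L x)) (b + (b o\<^sub>L y)) \<le> norm b * dist x y" for x y
    proof -
      have "norm (b o\<^sub>L (x - y)) \<le> norm b * norm (x - y)"
        by (rule norm_blinfun_compose)
      moreover have "b o\<^sub>L (x - y) = (b o\<^sub>L x) - (b o\<^sub>L y)"
        by (rule blinfun_eqI) (simp add: blinfun.diff_left blinfun.diff_right)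
      ultimately show "dist (b + (b o\<^sub>L x)) (b + (b o\<^sub>L y)) \<le> norm b * dist x y"
        by (simp add: dist_norm)
    qed
  qed (use b in auto)
  then obtain y where y: "y \<in> A" "b + (b o\<^sub>L y) = y"
    by blast
  have "\<sigma> y = \<sigma> (b + (b o\<^sub>L y))"
    using y by simp
  also have "\<dots> = 1 + \<sigma> y"
    using b(1) y(1) \<open>\<sigma> b = 1\<close> by (simp add: character_apply[OF \<sigma>] cstar_subalgebra_mem[OF A])
  finally show False
    by simp
qed

lemma sum_adj_square:
  assumes A: "cstar_subalgebra A" and \<sigma>: "\<sigma> \<in> max_ideal_space A"
    and F: "finite F" "F \<subseteq> {a \<in> A. \<sigma> a = 0}"
  shows "(\<Sum>a\<in>F. adj a o\<^sub>L a) \<in> A \<and> \<sigma> (\<Sum>a\<in>F. adj a o\<^sub>L a) = 0 \<and>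
    (\<forall>v. Re (cinner (blinfun_apply (\<Sum>a\<in>F. adj a o\<^sub>L a) v) v)
       = (\<Sum>a\<in>F. (norm (blinfun_apply a v))\<^sup>2))"
  using F
proof (induction F rule: finite_induct)
  case empty
  then show ?case
    by (simp add: cstar_subalgebra_mem[OF A] character_zero[OF A \<sigma>])
next
  case (insert a F)
  have a: "a \<in> A" "\<sigma> a = 0"
    using insert.prems by auto
  have "Re (cinner (blinfun_apply (adj a) (blinfun_apply a v)) v) = (norm (blinfun_apply a v))\<^sup>2" for v
    by (simp add: cinner_adj_left cstar_subalgebra_mem(1)[OF A a(1)] cinner_self)
  with insert a show ?case
    by (simp add: cstar_subalgebra_mem[OF A] character_apply[OF \<sigma>] blinfun.add_left cinner_add_left)
qed

text \<open>
  If finitely many \<open>a\<close> in the kernel were jointly bounded below, then \<open>h\<close>, the sum of the \<open>a\<^sup>* a\<close>, would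
  satisfy \<open>h \<ge> 1/D > 0\<close> although \<open>\<sigma>(h) = 0\<close>. Then \<open>1 - r h\<close> has norm less than 1 for small \<open>r > 0\<close>,
  while \<open>\<sigma>(1 - r h) = 1\<close>, contrary to \<open>character_contraction_neq_1\<close>.
\<close>

lemma kernel_jointly_singular:
  assumes A: "cstar_subalgebra A" "id_blinfun \<in> A" and \<sigma>: "\<sigma> \<in> max_ideal_space A"
  shows "jointly_singular {a \<in> A. \<sigma> a = 0}"
  unfolding jointly_singular_def
proof
  assume "dominated {a \<in> A. \<sigma> a = 0} (\<lambda>v. (norm v)\<^sup>2)"
  then obtain F C where F: "finite F" "F \<subseteq> {a \<in> A. \<sigma> a = 0}" "0 \<le> C"
    "\<And>v. (norm v)\<^sup>2 \<le> C * (\<Sum>a\<in>F. (norm (blinfun_apply a v))\<^sup>2)"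
    unfolding dominated_def by blast
  define h where "h = (\<Sum>a\<in>F. adj a o\<^sub>L a)"
  have h: "h \<in> A" "\<sigma> h = 0"
    "\<And>v. Re (cinner (blinfun_apply h v) v) = (\<Sum>a\<in>F. (norm (blinfun_apply a v))\<^sup>2)"
    using sum_adj_square[OF A(1) \<sigma> F(1,2)] by (auto simp: h_def)
  define D where "D = C + 1"
  define N where "N = (norm h)\<^sup>2 + 1"
  \<comment> \<open>With this \<open>r\<close> the term \<open>r\<^sup>2 \<parallel>h v\<parallel>\<^sup>2\<close> is at most half of \<open>2 r \<langle>h v, v\<rangle>\<close>.\<close>
  define r where "r = 1 / (D * N)"
  define b where "b = id_blinfun - scaleC_op (complex_of_real r) h"
  have D: "1 \<le> D"
    using F(3) by (simp add: D_def)
  have n1: "1 \<le> N"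
    by (simp add: N_def)
  have r: "0 < r" "r * (norm h)\<^sup>2 \<le> 1 / D" "r / D \<le> 1"
  proof -
    show "0 < r"
      using D n1 by (simp add: r_def)
    have "r * N = 1 / D"
      using D n1 by (simp add: r_def)
    then show "r * (norm h)\<^sup>2 \<le> 1 / D"
      using \<open>0 < r\<close> by (simp add: N_def distrib_left)
    have "1 * 1 \<le> D * N"
      using D n1 by (intro mult_mono) auto
    then have "r \<le> 1"
      using D n1 by (simp add: r_def divide_le_eq)
    then show "r / D \<le> 1"
      using D by (simp add: divide_le_eq)
  qed
  have "(norm (blinfun_apply b v))\<^sup>2 \<le> (1 - r / D) * (norm v)\<^sup>2" for v
  proof -
    have hv: "blinfun_apply b v = v - complex_of_real r *\<^sub>C blinfun_apply h v"
      by (simp add: b_def blinfun.diff_left scaleC_op.rep_eq)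
    have re: "Re (cinner v (complex_of_real r *\<^sub>C blinfun_apply h v))
        = r * Re (cinner (blinfun_apply h v) v)"
      by (subst cinner_commute) (simp add: cinner_scaleC_left)
    have nr: "(norm (complex_of_real r *\<^sub>C blinfun_apply h v))\<^sup>2 = r\<^sup>2 * (norm (blinfun_apply h v))\<^sup>2"
      by (simp add: norm_scaleC power_mult_distrib)
    have "(norm v)\<^sup>2 \<le> D * (\<Sum>a\<in>F. (norm (blinfun_apply a v))\<^sup>2)"
      using F(4)[of v] sum_nonneg[of F "\<lambda>a. (norm (blinfun_apply a v))\<^sup>2"]
      by (simp add: D_def distrib_right)
    then have "(norm v)\<^sup>2 / D \<le> Re (cinner (blinfun_apply h v) v)"
      using D by (simp add: h(3) divide_le_eq mult.commute)
    then have 1: "r * ((norm v)\<^sup>2 / D) \<le> r * Re (cinner (blinfun_apply h v) v)"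
      using r(1) by (intro mult_left_mono) auto
    have "(norm (blinfun_apply h v))\<^sup>2 \<le> (norm h)\<^sup>2 * (norm v)\<^sup>2"
      using power_mono[OF norm_blinfun[of h v], of 2] by (simp add: power_mult_distrib)
    then have "r\<^sup>2 * (norm (blinfun_apply h v))\<^sup>2 \<le> r\<^sup>2 * ((norm h)\<^sup>2 * (norm v)\<^sup>2)"
      by (intro mult_left_mono) auto
    also have "\<dots> = (r * (norm v)\<^sup>2) * (r * (norm h)\<^sup>2)"
      by (simp add: power2_eq_square)
    also have "\<dots> \<le> (r * (norm v)\<^sup>2) * (1 / D)"
      using r by (intro mult_left_mono) auto
    finally have 2: "r\<^sup>2 * (norm (blinfun_apply h v))\<^sup>2 \<le> r * ((norm v)\<^sup>2 / D)"
      by simp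
    show ?thesis
      unfolding hv norm_diff_sq re nr using 1 2 by (simp add: left_diff_distrib)
  qed
  then have "norm (blinfun_apply b v) \<le> sqrt (1 - r / D) * norm v" for v
    using real_le_rsqrt[of "norm (blinfun_apply b v)" "(1 - r / D) * (norm v)\<^sup>2"]
    by (simp add: real_sqrt_mult)
  then have "norm b \<le> sqrt (1 - r / D)"
    using r by (intro norm_blinfun_bound) auto
  also have "\<dots> < 1"
    using r D by simp
  finally have "norm b < 1" .
  moreover have "b \<in> A"
    unfolding b_def using A h by (intro cstar_subalgebra_diff cstar_subalgebra_mem)
  moreover have "\<sigma> b = 1"
    unfolding b_def using A h
    by (simp add: character_diff[OF A(1) \<sigma>] cstar_subalgebra_mem[OF A(1)] character_apply[OF \<sigma>]
        character_id[OF \<sigma> A(2)])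
  ultimately show False
    using character_contraction_neq_1[OF A(1) \<sigma>] by blast
qed

section \<open>Jointly singular families are annihilated by characters\<close>

lemma maximal_jointly_singular:
  assumes "jointly_singular J" "J \<subseteq> E"
  obtains M where "J \<subseteq> M" "M \<subseteq> E" "jointly_singular M"
    "\<And>x. x \<in> E \<Longrightarrow> jointly_singular (insert x M) \<Longrightarrow> x \<in> M"
proof -
  let ?\<A> = "{M. J \<subseteq> M \<and> M \<subseteq> E \<and> jointly_singular M}"
  have "\<exists>M\<in>?\<A>. \<forall>X\<in>?\<A>. M \<subseteq> X \<longrightarrow> X = M"
  proof (rule subset_Zorn_nonempty)
    show "?\<A> \<noteq> {}"
      using assms by blast
    fix \<C>
    assume \<C>: "\<C> \<noteq> {}" "subset.chain ?\<A> \<C>"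
    then have mem: "\<C> \<subseteq> ?\<A>"
      by (simp add: subset_chain_def)
    have "jointly_singular (\<Union>\<C>)"
    proof (rule jointly_singular_finite)
      fix F
      assume "finite F" "F \<subseteq> \<Union>\<C>"
      then obtain B where "B \<in> \<C>" "F \<subseteq> B"
        using finite_subset_Union_chain \<C> by blast
      then show "jointly_singular F"
        using mem jointly_singular_subset by blast
    qed
    then show "\<Union>\<C> \<in> ?\<A>"
      using mem \<C>(1) by blast
  qed
  then obtain M where M: "M \<in> ?\<A>" and max: "\<forall>X\<in>?\<A>. M \<subseteq> X \<longrightarrow> X = M"
    by (rule bexE)
  show thesis
  proof (rule that)
    show "J \<subseteq> M" "M \<subseteq> E" "jointly_singular M"
      using M by simp_all
    fix x
    assume "x \<in> E" "jointly_singular (insert x M)"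
    then have "insert x M = M"
      using M by (intro max[rule_format]) auto
    then show "x \<in> M"
      by blast
  qed
qed

text \<open>
  The value \<open>t\<close> is the largest one that \<open>\<parallel>a v\<parallel>\<^sup>2 / \<parallel>v\<parallel>\<^sup>2\<close> approaches on vectors \<open>v\<close> on which \<open>M\<close> is small.
  If \<open>v\<close> is such a vector then so is \<open>a v\<close>, because \<open>a\<close> commutes with \<open>M\<close>; hence
  \<open>\<parallel>a\<^sup>* a v\<parallel>\<^sup>2 = \<parallel>a a v\<parallel>\<^sup>2\<close> is at most about \<open>t \<parallel>a v\<parallel>\<^sup>2\<close>, and
  \<open>\<parallel>(a\<^sup>* a - t) v\<parallel>\<^sup>2 = \<parallel>a\<^sup>* a v\<parallel>\<^sup>2 - 2 t \<parallel>a v\<parallel>\<^sup>2 + t\<^sup>2 \<parallel>v\<parallel>\<^sup>2\<close> is at most about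
  \<open>t (t \<parallel>v\<parallel>\<^sup>2 - \<parallel>a v\<parallel>\<^sup>2)\<close>, which is small when \<open>\<parallel>a v\<parallel>\<^sup>2\<close> nearly attains its maximum \<open>t \<parallel>v\<parallel>\<^sup>2\<close>.
  This elementary existence of spectral values of positive elements takes the place of the
  Gelfand-Mazur theorem.
\<close>

lemma jointly_singular_insert_adj_square:
  fixes a :: "'h::complex_hilbert_space \<Rightarrow>\<^sub>L 'h"
  assumes M: "jointly_singular M" "\<And>T. T \<in> M \<Longrightarrow> T o\<^sub>L a = a o\<^sub>L T"
    and a: "a \<in> bounded_ops" "adj a o\<^sub>L a = a o\<^sub>L adj a"
  shows "\<exists>t::real. jointly_singular
    (insert ((adj a o\<^sub>L a) - scaleC_op (complex_of_real t) id_blinfun) M)"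
proof -
  let ?a = "blinfun_apply a"
  define S where "S = {t. dominated M (\<lambda>v. (norm (?a v))\<^sup>2 - t * (norm v)\<^sup>2)}"
  have small: "t \<le> 0" if "dominated M (\<lambda>v. t * (norm v)\<^sup>2)" for t
  proof (rule ccontr)
    assume "\<not> t \<le> 0"
    then show False
      using dominated_scale[OF that, of "1 / t"] M(1) by (simp add: jointly_singular_def)
  qed
  have S_nonneg: "0 \<le> t" if "t \<in> S" for t
  proof -
    have "dominated M (\<lambda>v. (- t) * (norm v)\<^sup>2)"
      by (rule dominated_mono[of M "\<lambda>v. (norm (?a v))\<^sup>2 - t * (norm v)\<^sup>2"])
        (use that in \<open>simp_all add: S_def\<close>)
    then show ?thesis
      using small[of "- t"] by simp
  qed
  have "(norm a)\<^sup>2 \<in> S"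
    unfolding S_def mem_Collect_eq
  proof (rule dominated_nonpos)
    show "(norm (?a v))\<^sup>2 - (norm a)\<^sup>2 * (norm v)\<^sup>2 \<le> 0" for v
      using power_mono[OF norm_blinfun[of a v], of 2] by (simp add: power_mult_distrib)
  qed
  then have S: "S \<noteq> {}" "bdd_below S"
    using S_nonneg unfolding bdd_below_def by blast+
  define L where "L = Inf S"
  have L0: "0 \<le> L"
    unfolding L_def using S(1) S_nonneg by (rule cInf_greatest)
  have L_le: "L \<le> t" if "t \<in> S" for t
    unfolding L_def using that S(2) by (rule cInf_lower)
  have above: "dominated M (\<lambda>v. (norm (?a v))\<^sup>2 - (L + x) * (norm v)\<^sup>2)" if "0 < x" for x
  proof -
    have "Inf S < L + x"
      using that by (simp add: L_def)
    then obtain t where t: "t \<in> S" "t < L + x"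
      using cInf_lessD[OF S(1)] by blast
    then have "t * (norm v)\<^sup>2 \<le> (L + x) * (norm v)\<^sup>2" for v :: 'h
      by (intro mult_right_mono) auto
    then show ?thesis
      using t(1) unfolding S_def by (auto intro: dominated_mono)
  qed
  define T where "T = (adj a o\<^sub>L a) - scaleC_op (complex_of_real L) id_blinfun"
  have aa: "blinfun_apply (adj a) (?a v) = ?a (blinfun_apply (adj a) v)" for v
    using a(2) by (metis blinfun_apply_blinfun_compose)
  have normal: "(norm (blinfun_apply (adj a) w))\<^sup>2 = (norm (?a w))\<^sup>2" for w
  proof -
    have "cinner (blinfun_apply (adj a) w) (blinfun_apply (adj a) w) = cinner (?a w) (?a w)"
      using cinner_adj_right[OF a(1), of "blinfun_apply (adj a) w" w]
        cinner_adj_left[OF a(1), of "?a w" w] by (simp add: aa)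
    then show ?thesis
      by (simp add: cinner_self del: of_real_power)
  qed
  have T_sq: "(norm (blinfun_apply T v))\<^sup>2
      = (norm (?a (?a v)))\<^sup>2 - 2 * L * (norm (?a v))\<^sup>2 + L\<^sup>2 * (norm v)\<^sup>2" for v
  proof -
    have "Re (cinner (blinfun_apply (adj a) (?a v)) (complex_of_real L *\<^sub>C v)) = L * (norm (?a v))\<^sup>2"
      by (simp add: cinner_scaleC_right cinner_adj_left[OF a(1)] cinner_self
          flip: of_real_power)
    then show ?thesis
      by (simp add: T_def blinfun.diff_left scaleC_op.rep_eq norm_diff_sq normal norm_scaleC
          power_mult_distrib)
  qed
  have "jointly_singular (insert T M)"
    unfolding jointly_singular_def
  proof
    assume "dominated (insert T M) (\<lambda>v. (norm v)\<^sup>2)"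
    then obtain K where K: "1 \<le> K"
      "dominated M (\<lambda>v. (norm v)\<^sup>2 - K * (norm (blinfun_apply T v))\<^sup>2)"
      using dominated_insert by blast
    \<comment> \<open>The expansion of \<open>\<parallel>(a\<^sup>* a - L) v\<parallel>\<^sup>2\<close> turned into a bound on \<open>\<parallel>a v\<parallel>\<^sup>2\<close>; for \<open>L > 0\<close> it is
      strictly better than \<open>L \<parallel>v\<parallel>\<^sup>2\<close> once \<open>x\<close> is small, against the choice of \<open>L\<close> as an infimum.\<close>
    have main: "dominated M (\<lambda>v. (1 - K * L\<^sup>2) * (norm v)\<^sup>2 + K * (L - x) * (norm (?a v))\<^sup>2)"
      if "0 < x" for x
    proof -
      have "dominated M (\<lambda>v. (norm (blinfun_apply T' (?a v)))\<^sup>2)" if "T' \<in> M" for T'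
      proof (rule dominated_norm_bound[OF dominated_member[OF that]])
        fix v
        have "blinfun_apply T' (?a v) = ?a (blinfun_apply T' v)"
          using M(2)[OF that] by (metis blinfun_apply_blinfun_compose)
        then show "norm (blinfun_apply T' (?a v)) \<le> norm a * norm (blinfun_apply T' v)"
          by (simp add: norm_blinfun)
      qed
      then have "dominated M (\<lambda>v. (norm (?a (?a v)))\<^sup>2 - (L + x) * (norm (?a v))\<^sup>2)"
        by (rule dominated_transfer[OF above[OF \<open>0 < x\<close>], where W = ?a])
      then have "dominated M (\<lambda>v. ((norm v)\<^sup>2 - K * (norm (blinfun_apply T v))\<^sup>2)
          + K * ((norm (?a (?a v)))\<^sup>2 - (L + x) * (norm (?a v))\<^sup>2))"
        using K by (intro dominated_add dominated_scale) auto
      then show ?thesis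
        by (rule dominated_mono) (simp add: T_sq algebra_simps)
    qed
    show False
    \<comment> \<open>If \<open>L = 0\<close> there is no better bound to derive; \<open>\<parallel>a v\<parallel>\<close> itself is small, and \<open>main\<close> bounds
      \<open>v\<close>.\<close>
    proof (cases "L = 0")
      case True
      define x where "x = 1 / (2 * K)"
      have x: "0 < x" "K * x * x < 1"
        using K(1) by (auto simp: x_def field_simps)
      have "dominated M (\<lambda>v. ((1 - K * L\<^sup>2) * (norm v)\<^sup>2 + K * (L - x) * (norm (?a v))\<^sup>2)
          + (K * x) * ((norm (?a v))\<^sup>2 - (L + x) * (norm v)\<^sup>2))"
        using K(1) x by (intro dominated_add main dominated_scale above) auto
      then have "dominated M (\<lambda>v. (1 - K * x * x) * (norm v)\<^sup>2)"
        by (rule dominated_mono) (simp add: True algebra_simps)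
      then show False
        using small x by fastforce
    next
      case False
      define x where "x = min (L / 2) (1 / (2 * K * L))"
      have x: "0 < x" "x < L" "K * L * x < 1"
      proof -
        show "0 < x" "x < L"
          using K(1) L0 False by (auto simp: x_def)
        have "K * L * x \<le> K * L * (1 / (2 * K * L))"
          unfolding x_def using K(1) L0 by (intro mult_left_mono) auto
        also have "\<dots> < 1"
          using K(1) False by simp
        finally show "K * L * x < 1" .
      qed
      have pos: "0 < K * (L - x)"
        using K(1) x by simp
      define t where "t = (K * L\<^sup>2 - 1) / (K * (L - x))"
      have "dominated M (\<lambda>v. (1 / (K * (L - x))) *
          ((1 - K * L\<^sup>2) * (norm v)\<^sup>2 + K * (L - x) * (norm (?a v))\<^sup>2))"
        using pos by (intro dominated_scale main x) auto
      then have "t \<in> S"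
        unfolding S_def mem_Collect_eq
      proof (rule dominated_mono)
        fix v
        have *: "n - (c / k) * m = (1 / k) * ((- c) * m + k * n)" if "k \<noteq> 0" for n m c k :: real
          using that by (simp add: field_simps)
        show "(norm (?a v))\<^sup>2 - t * (norm v)\<^sup>2 \<le> (1 / (K * (L - x))) *
            ((1 - K * L\<^sup>2) * (norm v)\<^sup>2 + K * (L - x) * (norm (?a v))\<^sup>2)"
          unfolding t_def by (subst *) (use pos in auto)
      qed
      then have "L * (K * (L - x)) \<le> K * L\<^sup>2 - 1"
        using L_le[of t] pos by (simp add: t_def pos_le_divide_eq)
      then show False
        using x(3) by (simp add: algebra_simps power2_eq_square)
    qed
  qed
  then show ?thesis
    unfolding T_def by blast
qed

text \<open>
  Every element is a linear combination of elements \<open>b\<^sup>* b\<close>, so values need to be found for those only.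
\<close>

lemma polarization:
  fixes a :: "'h::complex_hilbert_space \<Rightarrow>\<^sub>L 'h"
  assumes "a \<in> bounded_ops"
  defines "b \<equiv> \<lambda>c. id_blinfun + scaleC_op c a"
  shows "a = scaleC_op (1/4) ((adj (b 1) o\<^sub>L b 1) + scaleC_op (- 1) (adj (b (- 1)) o\<^sub>L b (- 1))
    + scaleC_op (- \<i>) (adj (b \<i>) o\<^sub>L b \<i>) + scaleC_op \<i> (adj (b (- \<i>)) o\<^sub>L b (- \<i>)))"
proof (rule blinfun_eqI)
  fix v
  define x y z where "x = blinfun_apply a v" and "y = blinfun_apply (adj a) v"
    and "z = blinfun_apply (adj a) (blinfun_apply a v)"
  have b: "blinfun_apply (adj (b c) o\<^sub>L b c) v = v + c *\<^sub>C x + cnj c *\<^sub>C y + (cnj c * c) *\<^sub>C z" for c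
    using assms(1) by (simp add: b_def adj_id_plus_scale blinfun.add_left blinfun.add_right
        scaleC_op.rep_eq bounded_opsD adj_bounded_ops scaleC_add_right scaleC_scaleC x_def y_def z_def)
  have four: "4 *\<^sub>C x = x + x + x + x"
    using scaleC_add_left[of 2 2 x] scaleC_add_left[of 1 1 x] by simp
  have "(1/4) *\<^sub>C 4 *\<^sub>C x = x"
    by (simp add: scaleC_scaleC)
  moreover have "blinfun_apply ((adj (b 1) o\<^sub>L b 1) + scaleC_op (- 1) (adj (b (- 1)) o\<^sub>L b (- 1))
    + scaleC_op (- \<i>) (adj (b \<i>) o\<^sub>L b \<i>) + scaleC_op \<i> (adj (b (- \<i>)) o\<^sub>L b (- \<i>))) v = 4 *\<^sub>C x"
    unfolding blinfun.add_left scaleC_op.rep_eq b four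
    by (simp add: scaleC_add_right scaleC_diff_right scaleC_scaleC scaleC_minus_left scaleC_minus_one)
  ultimately show "blinfun_apply a v = blinfun_apply (scaleC_op (1/4) ((adj (b 1) o\<^sub>L b 1)
    + scaleC_op (- 1) (adj (b (- 1)) o\<^sub>L b (- 1))
    + scaleC_op (- \<i>) (adj (b \<i>) o\<^sub>L b \<i>) + scaleC_op \<i> (adj (b (- \<i>)) o\<^sub>L b (- \<i>)))) v"
    by (simp add: scaleC_op.rep_eq x_def)
qed

text \<open>
  A maximal jointly singular family \<open>M\<close> containing \<open>J\<close> behaves like the kernel of a character. It contains
  every operator that it dominates, hence for \<open>a\<close> and \<open>b\<close> with \<open>a - c\<close> and \<open>b - d\<close> in \<open>M\<close> also
  \<open>(a + b) - (c + d)\<close> and \<open>a b - c d\<close> are in \<open>M\<close>; the number \<open>c\<close> is determined by \<open>a\<close>, and it exists for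
  every \<open>a\<close> by \<open>jointly_singular_insert_adj_square\<close> and \<open>polarization\<close>. So \<open>a \<mapsto> c\<close> is the character.
\<close>

theorem character_annihilating:
  fixes E :: "('h::complex_hilbert_space \<Rightarrow>\<^sub>L 'h) set"
  assumes E: "cstar_subalgebra E" "commutative_ops E" "id_blinfun \<in> E"
    and J: "jointly_singular J" "J \<subseteq> E"
  shows "\<exists>\<phi>\<in>max_ideal_space E. \<forall>T\<in>J. \<phi> T = 0"
proof -
  obtain M where M: "J \<subseteq> M" "M \<subseteq> E" "jointly_singular M"
    and max: "\<And>x. x \<in> E \<Longrightarrow> jointly_singular (insert x M) \<Longrightarrow> x \<in> M"
    using maximal_jointly_singular[OF J] by blast
  note mem = cstar_subalgebra_mem[OF E(1)]
  have saturated: "x \<in> M"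
    if "x \<in> E" "dominated M (\<lambda>v. (norm (blinfun_apply x v))\<^sup>2)" for x
  proof (rule max[OF that(1)], rule jointly_singular_transfer[OF M(3), where W = "\<lambda>v. v" and K = 1])
    show "dominated M (\<lambda>v. (norm (blinfun_apply T v))\<^sup>2)" if "T \<in> insert x M" for T
      using that \<open>dominated M _\<close> by (auto intro: dominated_member)
  qed (auto intro: dominated_nonpos)
  define P where "P a c \<longleftrightarrow> a \<in> E \<and> a - scaleC_op c id_blinfun \<in> M" for a c
  have PI: "P a c" if "a \<in> E" "dominated M (\<lambda>v. (norm (blinfun_apply a v - c *\<^sub>C v))\<^sup>2)" for a c
    unfolding P_def using that E
    by (auto intro!: saturated cstar_subalgebra_diff[OF E(1)] mem
        simp: blinfun.diff_left scaleC_op.rep_eq)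
  have PD: "a \<in> E" "dominated M (\<lambda>v. (norm (blinfun_apply a v - c *\<^sub>C v))\<^sup>2)" if "P a c" for a c
    using that dominated_member[of "a - scaleC_op c id_blinfun" M]
    by (auto simp: P_def blinfun.diff_left scaleC_op.rep_eq)
  have P_add: "P (a + b) (c + d)" if "P a c" "P b d" for a b c d
  proof (rule PI)
    have "blinfun_apply (a + b) v - (c + d) *\<^sub>C v
        = (blinfun_apply a v - c *\<^sub>C v) + (blinfun_apply b v - d *\<^sub>C v)" for v
      by (simp add: blinfun.add_left scaleC_add_left)
    then show "dominated M (\<lambda>v. (norm (blinfun_apply (a + b) v - (c + d) *\<^sub>C v))\<^sup>2)"
      using dominated_norm_add[OF PD(2)[OF that(1)] PD(2)[OF that(2)]] by simp
  qed (auto intro: mem(3-5) PD(1) that)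
  have P_scale: "P (scaleC_op d a) (d * c)" if "P a c" for a c d
  proof (rule PI)
    have "blinfun_apply (scaleC_op d a) v - (d * c) *\<^sub>C v = d *\<^sub>C (blinfun_apply a v - c *\<^sub>C v)" for v
      by (simp add: scaleC_op.rep_eq scaleC_diff_right scaleC_scaleC)
    then show "dominated M (\<lambda>v. (norm (blinfun_apply (scaleC_op d a) v - (d * c) *\<^sub>C v))\<^sup>2)"
      by (intro dominated_norm_bound[OF PD(2)[OF that], where K = "cmod d"]) (simp add: norm_scaleC)
  qed (auto intro: mem(3-5) PD(1) that)
  have P_mult: "P (a o\<^sub>L b) (c * d)" if "P a c" "P b d" for a b c d
  proof (rule PI)
    have "blinfun_apply (a o\<^sub>L b) v - (c * d) *\<^sub>C v
        = blinfun_apply a (blinfun_apply b v - d *\<^sub>C v) + d *\<^sub>C (blinfun_apply a v - c *\<^sub>C v)" for v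
      using bounded_opsD[OF mem(1)[OF PD(1)[OF that(1)]]]
      by (simp add: blinfun.diff_right scaleC_diff_right scaleC_scaleC mult.commute)
    moreover have "dominated M (\<lambda>v. (norm (blinfun_apply a (blinfun_apply b v - d *\<^sub>C v)))\<^sup>2)"
      by (rule dominated_norm_bound[OF PD(2)[OF that(2)] norm_blinfun])
    moreover have "dominated M (\<lambda>v. (norm (d *\<^sub>C (blinfun_apply a v - c *\<^sub>C v)))\<^sup>2)"
      by (rule dominated_norm_bound[OF PD(2)[OF that(1)], where K = "cmod d"]) (simp add: norm_scaleC)
    ultimately show "dominated M (\<lambda>v. (norm (blinfun_apply (a o\<^sub>L b) v - (c * d) *\<^sub>C v))\<^sup>2)"
      using dominated_norm_add by simp
  qed (auto intro: mem(3-5) PD(1) that)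
  have P_unique: "c = d" if "P a c" "P a d" for a c d
  proof (rule ccontr)
    assume "c \<noteq> d"
    have "P (a + scaleC_op (- 1) a) (c + (- 1) * d)"
      using that by (intro P_add P_scale)
    moreover have "a + scaleC_op (- 1) a = 0"
      by (simp flip: diff_eq_add_scaleC_op)
    ultimately have "dominated M (\<lambda>v. (norm ((c - d) *\<^sub>C v))\<^sup>2)"
      using PD(2)[of 0 "c - d"] by (simp add: scaleC_minus_left[symmetric] norm_scaleC norm_minus_commute[of d c])
    then have "dominated M (\<lambda>v. (norm v)\<^sup>2)"
      by (rule dominated_norm_bound[where K = "1 / cmod (c - d)"])
        (use \<open>c \<noteq> d\<close> in \<open>simp add: norm_scaleC\<close>)
    then show False
      using M(3) by (simp add: jointly_singular_def)
  qed
  have P_square: "\<exists>c. P (adj b o\<^sub>L b) c" if b: "b \<in> E" for b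
  proof -
    have comm: "x o\<^sub>L y = y o\<^sub>L x" if "x \<in> E" "y \<in> E" for x y
      using E(2) that by (auto simp: commutative_ops_def)
    have "\<exists>t::real. jointly_singular
        (insert ((adj b o\<^sub>L b) - scaleC_op (complex_of_real t) id_blinfun) M)"
      using M(2) b
      by (intro jointly_singular_insert_adj_square M(3) mem(1) comm mem(6)) auto
    then obtain t :: real where t: "jointly_singular
        (insert ((adj b o\<^sub>L b) - scaleC_op (complex_of_real t) id_blinfun) M)"
      by blast
    have "P (adj b o\<^sub>L b) (complex_of_real t)"
      unfolding P_def using b E(3) by (intro conjI max t cstar_subalgebra_diff[OF E(1)] mem(4-6))
    then show ?thesis
      by blast
  qed
  have P_exists: "\<exists>c. P a c" if a: "a \<in> E" for a
  proof -
    let ?b = "\<lambda>c. id_blinfun + scaleC_op c a"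
    have "\<exists>d. P (adj (?b c) o\<^sub>L ?b c) d" for c
      using a E(3) by (intro P_square mem(3,4))
    then obtain d where d: "\<And>c. P (adj (?b c) o\<^sub>L ?b c) (d c)"
      by metis
    have "P a ((1/4) * (d 1 + (- 1) * d (- 1) + (- \<i>) * d \<i> + \<i> * d (- \<i>)))"
      by (subst polarization[OF mem(1)[OF a]]) (intro P_scale P_add d)
    then show ?thesis
      by blast
  qed
  define \<phi> where "\<phi> = (\<lambda>a\<in>E. THE c. P a c)"
  have \<phi>: "\<phi> a = c" if "P a c" for a c
    using that PD(1)[OF that] P_unique by (auto simp: \<phi>_def intro!: the_equality)
  have P\<phi>: "P a (\<phi> a)" if "a \<in> E" for a
    using P_exists[OF that] \<phi> by blast
  have "P id_blinfun 1"
    using E(3) by (intro PI) (auto intro: dominated_nonpos)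
  then have "\<phi> id_blinfun \<noteq> 0"
    using \<phi> by simp
  moreover have "\<phi> \<in> extensional E"
    by (simp add: \<phi>_def)
  ultimately have "\<phi> \<in> max_ideal_space E"
    unfolding max_ideal_space_def mem_Collect_eq
    by (intro conjI ballI allI bexI[of _ id_blinfun] E(3))
      (auto intro!: \<phi> P_add P_scale P_mult P\<phi>)
  moreover have "\<phi> T = 0" if "T \<in> J" for T
  proof (rule \<phi>, rule PI)
    show "T \<in> E"
      using that J by blast
    show "dominated M (\<lambda>v. (norm (blinfun_apply T v - 0 *\<^sub>C v))\<^sup>2)"
      using dominated_member[of T M] that M(1) by auto
  qed
  ultimately show ?thesis
    by blast
qed

section \<open>The C*-algebra generated by a commuting self-adjoint family\<close>

lemma closed_bounded_ops: "closed (bounded_ops :: ('h::complex_hilbert_space \<Rightarrow>\<^sub>L 'h) set)"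
proof -
  have "continuous_on UNIV (\<lambda>T. blinfun_apply T (c *\<^sub>C x))"
    "continuous_on UNIV (\<lambda>T. c *\<^sub>C blinfun_apply T x)" for c and x :: 'h
    by (intro continuous_intros bounded_linear.continuous_on[OF bounded_linear_scaleC])+
  then show ?thesis
    unfolding bounded_ops_def by (intro closed_Collect_all closed_Collect_eq)
qed

text \<open>
  Commutants are the only C*-algebras that have to be exhibited by hand; that the generated algebra lies
  in \<open>L(H)\<close> and is commutative both follow by comparing it with suitable commutants.
\<close>

lemma commutant_cstar_subalgebra:
  assumes S: "S \<subseteq> bounded_ops" "\<And>s. s \<in> S \<Longrightarrow> adj s \<in> S"
  shows "cstar_subalgebra (commutant S)"
proof -
  have op: "s \<in> bounded_ops" if "s \<in> S" for s
    using that S by blast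
  have adj: "adj a \<in> commutant S" if "a \<in> commutant S" for a
  proof -
    have a: "a \<in> bounded_ops" "\<And>s. s \<in> S \<Longrightarrow> a o\<^sub>L s = s o\<^sub>L a"
      using that by (auto simp: commutant_def)
    have "adj a o\<^sub>L s = s o\<^sub>L adj a" if "s \<in> S" for s
    proof -
      have "adj (adj s o\<^sub>L a) = adj (a o\<^sub>L adj s)"
        using a(2)[OF S(2)[OF that]] by simp
      then show ?thesis
        using a(1) op[OF that] by (simp add: adj_compose adj_bounded_ops adj_adj)
    qed
    then show ?thesis
      using a(1) by (simp add: commutant_def adj_bounded_ops)
  qed
  have "closed (bounded_ops \<inter> (\<Inter>s\<in>S. {T. T o\<^sub>L s = s o\<^sub>L T}))"
    by (intro closed_Int closed_INT closed_bounded_ops ballI closed_Collect_eq)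
      (intro continuous_intros)+
  moreover have "commutant S = bounded_ops \<inter> (\<Inter>s\<in>S. {T. T o\<^sub>L s = s o\<^sub>L T})"
    by (auto simp: commutant_def)
  ultimately have cl: "closed (commutant S)"
    by simp
  have comm: "blinfun_apply a (blinfun_apply s x) = blinfun_apply s (blinfun_apply a x)"
    if "a \<in> commutant S" "s \<in> S" for a s x
    using that unfolding commutant_def by (metis (mono_tags, lifting) blinfun_apply_blinfun_compose mem_Collect_eq)
  have I: "a \<in> commutant S"
    if "a \<in> bounded_ops"
      "\<And>s x. s \<in> S \<Longrightarrow> blinfun_apply a (blinfun_apply s x) = blinfun_apply s (blinfun_apply a x)" for a
    using that by (auto simp: commutant_def intro!: blinfun_eqI)
  have b: "a \<in> bounded_ops" if "a \<in> commutant S" for a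
    using that by (simp add: commutant_def)
  show ?thesis
    unfolding cstar_subalgebra_def
  proof (intro conjI ballI allI adj cl)
    show "commutant S \<subseteq> bounded_ops"
      using b by blast
    show "0 \<in> commutant S"
    proof (rule I)
      show "(0 :: 'a \<Rightarrow>\<^sub>L 'a) \<in> bounded_ops"
        using scaleC_op_bounded_ops[OF id_bounded_ops, of 0]
        by (auto simp: bounded_ops_def scaleC_op.rep_eq)
    qed (simp add: blinfun.zero_right)
    fix a
    assume a: "a \<in> commutant S"
    show "scaleC_op c a \<in> commutant S" for c
      by (rule I) (simp_all add: scaleC_op_bounded_ops b[OF a] scaleC_op.rep_eq comm[OF a]
          bounded_opsD[OF op])
    fix b'
    assume b': "b' \<in> commutant S"
    show "a + b' \<in> commutant S"
      by (rule I) (simp_all add: add_bounded_ops b[OF a] b[OF b'] blinfun.add_left blinfun.add_right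
          comm[OF a] comm[OF b'])
    show "a o\<^sub>L b' \<in> commutant S"
      by (rule I) (simp_all add: compose_bounded_ops b[OF a] b[OF b'] comm[OF a] comm[OF b'])
  qed
qed

lemma
  assumes S: "S \<subseteq> bounded_ops" "\<And>s. s \<in> S \<Longrightarrow> adj s \<in> S"
  shows cstar_subalgebra_generated: "cstar_subalgebra (cstar_generated S)"
    and commutative_generated:
      "(\<And>s t. s \<in> S \<Longrightarrow> t \<in> S \<Longrightarrow> s o\<^sub>L t = t o\<^sub>L s) \<Longrightarrow> commutative_ops (cstar_generated S)"
    and generators_subset: "S \<subseteq> cstar_generated S"
proof -
  let ?E = "cstar_generated S"
  let ?B = "{B. cstar_subalgebra B \<and> S \<subseteq> B}"
  have sub: "?E \<subseteq> B" if "cstar_subalgebra B" "S \<subseteq> B" for B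
    using that by (auto simp: cstar_generated_def)
  show SE: "S \<subseteq> ?E"
    by (auto simp: cstar_generated_def)
  have "S \<subseteq> commutant {}"
    using S by (auto simp: commutant_def)
  then have "?E \<subseteq> commutant {}"
    by (intro sub commutant_cstar_subalgebra) auto
  then have Eb: "?E \<subseteq> bounded_ops"
    by (auto simp: commutant_def)
  have "closed ?E"
    unfolding cstar_generated_def by (rule closed_Inter) (auto simp: cstar_subalgebra_def)
  then show E: "cstar_subalgebra ?E"
    using Eb unfolding cstar_subalgebra_def cstar_generated_def by auto
  show "commutative_ops ?E" if "\<And>s t. s \<in> S \<Longrightarrow> t \<in> S \<Longrightarrow> s o\<^sub>L t = t o\<^sub>L s"
  proof -
    \<comment> \<open>The bicommutant argument: the generators commute with each other, hence the algebra with
      the generators, hence the generators with the algebra, hence the algebra with itself.\<close>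
    have "S \<subseteq> commutant S"
      using S that by (auto simp: commutant_def)
    then have "?E \<subseteq> commutant S"
      using S by (intro sub commutant_cstar_subalgebra)
    then have "S \<subseteq> commutant ?E"
      using S unfolding commutant_def by fastforce
    moreover have "cstar_subalgebra (commutant ?E)"
      using Eb cstar_subalgebra_mem(6)[OF E] by (rule commutant_cstar_subalgebra)
    ultimately have "?E \<subseteq> commutant ?E"
      by (intro sub)
    then show ?thesis
      by (auto simp: commutant_def commutative_ops_def)
  qed
qed

section \<open>Iterates of an operator\<close>

lemma funpow_blinfun_diff:
  fixes T :: "'a::real_normed_vector \<Rightarrow>\<^sub>L 'a"
  shows "((blinfun_apply T) ^^ n) (x - y) = ((blinfun_apply T) ^^ n) x - ((blinfun_apply T) ^^ n) y"
  by (induction n) (simp_all add: blinfun.diff_right)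

lemma funpow_bounded_ops_scaleC:
  "T \<in> bounded_ops \<Longrightarrow> ((blinfun_apply T) ^^ n) (c *\<^sub>C x) = c *\<^sub>C ((blinfun_apply T) ^^ n) x"
  by (induction n) (simp_all add: bounded_opsD)

lemma norm_funpow_blinfun:
  fixes T :: "'a::real_normed_vector \<Rightarrow>\<^sub>L 'a"
  shows "norm (((blinfun_apply T) ^^ n) x) \<le> norm T ^ n * norm x"
proof (induction n)
  case (Suc n)
  have "norm (((blinfun_apply T) ^^ Suc n) x) \<le> norm T * norm (((blinfun_apply T) ^^ n) x)"
    by (simp add: norm_blinfun)
  also have "\<dots> \<le> norm T * (norm T ^ n * norm x)"
    using Suc by (intro mult_left_mono) auto
  finally show ?case
    by (simp add: mult.assoc)
qed simp

lemma funpow_split: "k \<le> n \<Longrightarrow> (f ^^ n) x = (f ^^ k) ((f ^^ (n - k)) x)"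
  by (metis comp_apply funpow_add le_add_diff_inverse)

lemma funpow_split': "k \<le> n \<Longrightarrow> (f ^^ n) x = (f ^^ (n - k)) ((f ^^ k) x)"
  by (metis comp_apply funpow_add le_add_diff_inverse2)

section \<open>The endomorphism and its iterates\<close>

text \<open>
  The operators \<open>U\<close> and \<open>U\<^sup>*\<close> and their iterates are used as maps on vectors, for which function iteration
  and its lemmas are available. The element \<open>range_proj n\<close> is \<open>\<delta>\<^sup>n(1) = U\<^sup>n U\<^sup>*\<^sup>n\<close>.
\<close>

locale partial_isometry_endomorphism =
  fixes A :: "('h::complex_hilbert_space \<Rightarrow>\<^sub>L 'h) set" and U :: "'h \<Rightarrow>\<^sub>L 'h"
  assumes A: "cstar_subalgebra A" and A_comm: "commutative_ops A" and A_id: "id_blinfun \<in> A"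
    and U_pi: "partial_isometry U"
    and endo: "star_endomorphism A (delta U)"
    and initial_comm: "adj U o\<^sub>L U \<in> commutant A"
begin

abbreviation u where "u \<equiv> blinfun_apply U"
abbreviation w where "w \<equiv> blinfun_apply (adj U)"
abbreviation d where "d \<equiv> delta U"
abbreviation ds where "ds \<equiv> delta_star U"
abbreviation range_proj where "range_proj n \<equiv> (d ^^ n) id_blinfun"

lemmas A_mem = cstar_subalgebra_mem[OF A]

lemma U_op: "U \<in> bounded_ops"
  using U_pi by (simp add: partial_isometry_def)

lemma d_mem: "a \<in> A \<Longrightarrow> d a \<in> A"
  using endo by (simp add: star_endomorphism_def)

lemma d_pow_mem: "a \<in> A \<Longrightarrow> (d ^^ n) a \<in> A"
  by (induction n) (simp_all add: d_mem)

lemma A_comm_apply: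
  "a \<in> A \<Longrightarrow> b \<in> A \<Longrightarrow> blinfun_apply a (blinfun_apply b x) = blinfun_apply b (blinfun_apply a x)"
  using A_comm unfolding commutative_ops_def by (metis blinfun_apply_blinfun_compose)

lemma initial_comm_apply: "a \<in> A \<Longrightarrow> w (u (blinfun_apply a x)) = blinfun_apply a (w (u x))"
proof -
  assume "a \<in> A"
  then have "blinfun_apply ((adj U o\<^sub>L U) o\<^sub>L a) x = blinfun_apply (a o\<^sub>L (adj U o\<^sub>L U)) x"
    using initial_comm by (simp add: commutant_def)
  then show ?thesis
    by simp
qed

lemma uwu: "u (w (u x)) = u x"
proof -
  have "blinfun_apply (U o\<^sub>L adj U o\<^sub>L U) x = u x"
    by (simp only: partial_isometry_triple_product[OF U_pi])
  then show ?thesis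
    by simp
qed

lemma wuw: "w (u (w x)) = w x"
proof -
  have "adj (U o\<^sub>L adj U o\<^sub>L U) = adj U o\<^sub>L (U o\<^sub>L adj U)"
    using U_op by (simp add: adj_compose adj_adj adj_bounded_ops compose_bounded_ops)
  then have "blinfun_apply (adj U) x = blinfun_apply (adj U o\<^sub>L (U o\<^sub>L adj U)) x"
    by (simp only: partial_isometry_triple_product[OF U_pi])
  then show ?thesis
    by simp
qed

lemma d_apply: "blinfun_apply (d a) x = u (blinfun_apply a (w x))"
  by (simp add: delta_def)

text \<open>
  The relation \<open>U a = \<delta>(a) U\<close>, and its companion \<open>a U\<^sup>* = U\<^sup>* \<delta>(a)\<close> below, hold because
  \<open>\<delta>(a) U = U a U\<^sup>* U = U U\<^sup>* U a\<close>. All computations with iterates are reduced to them.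
\<close>

lemma u_intertwines: "a \<in> A \<Longrightarrow> u (blinfun_apply a x) = blinfun_apply (d a) (u x)"
  by (simp add: d_apply initial_comm_apply[symmetric] uwu)

lemma w_intertwines: "a \<in> A \<Longrightarrow> blinfun_apply a (w x) = w (blinfun_apply (d a) x)"
  by (simp add: d_apply initial_comm_apply wuw)

lemma u_pow_intertwines:
  "a \<in> A \<Longrightarrow> (u ^^ n) (blinfun_apply a x) = blinfun_apply ((d ^^ n) a) ((u ^^ n) x)"
  by (induction n) (simp_all add: u_intertwines d_pow_mem)

lemma w_pow_intertwines:
  "a \<in> A \<Longrightarrow> blinfun_apply a ((w ^^ n) x) = (w ^^ n) (blinfun_apply ((d ^^ n) a) x)"
proof (induction n arbitrary: x)
  case (Suc n)
  have "blinfun_apply a ((w ^^ Suc n) x) = blinfun_apply a ((w ^^ n) (w x))"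
    by (simp add: funpow_swap1)
  also have "\<dots> = (w ^^ n) (w (blinfun_apply (d ((d ^^ n) a)) x))"
    using Suc by (simp add: w_intertwines d_pow_mem)
  finally show ?case
    by (simp add: funpow_swap1)
qed simp

lemma d_pow_apply: "blinfun_apply ((d ^^ n) a) x = (u ^^ n) (blinfun_apply a ((w ^^ n) x))"
  by (induction n arbitrary: x) (simp_all add: d_apply funpow_swap1[of w])

lemma ds_pow_apply: "blinfun_apply ((ds ^^ n) a) x = (w ^^ n) (blinfun_apply a ((u ^^ n) x))"
  by (induction n arbitrary: x) (simp_all add: delta_star_def funpow_swap1[of u])

lemma range_proj_apply: "(u ^^ n) ((w ^^ n) x) = blinfun_apply (range_proj n) x"
  by (simp add: d_pow_apply)

lemma d_pow_range_proj: "k \<le> n \<Longrightarrow> (d ^^ (n - k)) (range_proj k) = range_proj n"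
  by (rule funpow_split'[symmetric])

lemma range_proj_mem: "range_proj n \<in> A"
  by (rule d_pow_mem[OF A_id])

text \<open>
  In \<open>\<delta>\<^sub>*\<^sup>k(a) U\<^sup>*\<^sup>n = U\<^sup>*\<^sup>k a U\<^sup>k U\<^sup>*\<^sup>k U\<^sup>*\<^sup>n\<^sup>-\<^sup>k\<close> the product \<open>U\<^sup>k U\<^sup>*\<^sup>k\<close> is the element \<open>\<delta>\<^sup>k(1)\<close> of \<open>A\<close>, and both it
  and \<open>a\<close> can be moved through \<open>U\<^sup>*\<^sup>n\<^sup>-\<^sup>k\<close>. So on the range of \<open>U\<^sup>*\<^sup>n\<close> the generators of level at most
  \<open>n\<close> act like elements of \<open>A\<close>.
\<close>

lemma ds_pow_apply_w_pow:
  assumes "a \<in> A" "k \<le> n"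
  shows "blinfun_apply ((ds ^^ k) a) ((w ^^ n) x)
    = (w ^^ n) (blinfun_apply ((d ^^ (n - k)) a) (blinfun_apply (range_proj n) x))"
proof -
  have "blinfun_apply ((ds ^^ k) a) ((w ^^ n) x)
      = (w ^^ k) (blinfun_apply a (blinfun_apply (range_proj k) ((w ^^ (n - k)) x)))"
    using assms(2) by (simp add: ds_pow_apply funpow_split[of k n w] range_proj_apply)
  also have "\<dots> = (w ^^ k) ((w ^^ (n - k)) (blinfun_apply ((d ^^ (n - k)) a) (blinfun_apply (range_proj n) x)))"
    using assms by (simp add: w_pow_intertwines range_proj_mem d_pow_range_proj)
  finally show ?thesis
    using assms(2) by (simp add: funpow_split[of k n w])
qed

text \<open>
  Both products equal \<open>U\<^sup>*\<^sup>l c U\<^sup>l\<close> with the same \<open>c \<in> A\<close>, the product of \<open>b\<close>, \<open>\<delta>\<^sup>l(1)\<close> and \<open>\<delta>\<^sup>l\<^sup>-\<^sup>k(a)\<close>.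
\<close>

lemma ds_pow_commute_le:
  assumes "a \<in> A" "b \<in> A" "k \<le> l"
  shows "(ds ^^ k) a o\<^sub>L (ds ^^ l) b = (ds ^^ l) b o\<^sub>L (ds ^^ k) a"
proof (rule blinfun_eqI)
  fix x
  have "(u ^^ l) (blinfun_apply ((ds ^^ k) a) x)
      = (u ^^ (l - k)) (blinfun_apply (range_proj k) (blinfun_apply a ((u ^^ k) x)))"
    using assms(3) by (simp add: ds_pow_apply funpow_split'[of k l u] range_proj_apply)
  also have "\<dots> = blinfun_apply (range_proj l) (blinfun_apply ((d ^^ (l - k)) a) ((u ^^ l) x))"
    using assms by (simp add: u_pow_intertwines range_proj_mem d_pow_range_proj
        funpow_split'[of k l u])
  finally show "blinfun_apply ((ds ^^ k) a o\<^sub>L (ds ^^ l) b) x = blinfun_apply ((ds ^^ l) b o\<^sub>L (ds ^^ k) a) x"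
    using assms A_comm_apply d_pow_mem range_proj_mem
    by (simp add: ds_pow_apply[of l b] ds_pow_apply_w_pow)
qed

definition coefficients where "coefficients = (\<Union>n. (ds ^^ n) ` A)"

lemma ds_pow_adj:
  assumes "a \<in> A"
  shows "(ds ^^ n) a \<in> bounded_ops \<and> adj ((ds ^^ n) a) = (ds ^^ n) (adj a)"
proof (induction n)
  case 0
  then show ?case
    using assms A_mem by simp
next
  case (Suc n)
  then have "adj (adj U o\<^sub>L (ds ^^ n) a o\<^sub>L U) = adj U o\<^sub>L (adj ((ds ^^ n) a) o\<^sub>L U)"
    using U_op by (simp add: adj_compose adj_adj adj_bounded_ops compose_bounded_ops)
  also have "\<dots> = adj U o\<^sub>L adj ((ds ^^ n) a) o\<^sub>L U"
    by (rule blinfun_eqI) simp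
  finally show ?case
    using Suc U_op
    by (simp add: delta_star_def[of U "(ds ^^ n) x" for x] compose_bounded_ops adj_bounded_ops)
qed

lemma coefficient_algebra_facts:
  "cstar_subalgebra (coefficient_algebra A U)" "commutative_ops (coefficient_algebra A U)"
  "a \<in> A \<Longrightarrow> (ds ^^ n) a \<in> coefficient_algebra A U"
proof -
  have ops: "coefficients \<subseteq> bounded_ops"
    using ds_pow_adj by (auto simp: coefficients_def)
  have adj: "adj s \<in> coefficients" if "s \<in> coefficients" for s
    using that ds_pow_adj A_mem(6) by (fastforce simp: coefficients_def)
  have comm: "s o\<^sub>L t = t o\<^sub>L s" if st: "s \<in> coefficients" "t \<in> coefficients" for s t
  proof -
    obtain a b k l where "a \<in> A" "b \<in> A" "s = (ds ^^ k) a" "t = (ds ^^ l) b"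
      using st by (auto simp: coefficients_def)
    then show ?thesis
      using ds_pow_commute_le[of a b k l] ds_pow_commute_le[of b a l k] by (cases "k \<le> l") auto
  qed
  have E: "coefficient_algebra A U = cstar_generated coefficients"
    by (simp add: coefficient_algebra_def coefficients_def)
  show "cstar_subalgebra (coefficient_algebra A U)"
    unfolding E using ops adj by (rule cstar_subalgebra_generated)
  show "commutative_ops (coefficient_algebra A U)"
    unfolding E using ops adj comm by (rule commutative_generated)
  have "coefficients \<subseteq> cstar_generated coefficients"
    using ops adj by (rule generators_subset)
  then show "(ds ^^ n) a \<in> coefficient_algebra A U" if "a \<in> A"
    unfolding E using that by (auto simp: coefficients_def)
qed

section \<open>Realising sequences of characters\<close>

definition deviations where
  "deviations s = (\<lambda>(n, a). (ds ^^ n) a - scaleC_op (s n a) id_blinfun) ` (UNIV \<times> A)"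

lemma realised_if_deviations_singular:
  assumes "jointly_singular (deviations s)" "\<And>n. s n \<in> extensional A"
  shows "s \<in> xi A U ` max_ideal_space (coefficient_algebra A U)"
proof -
  let ?E = "coefficient_algebra A U"
  note E = coefficient_algebra_facts
  have E_id: "id_blinfun \<in> ?E"
    using E(3)[OF A_id, of 0] by simp
  note E_mem = cstar_subalgebra_mem[OF E(1)]
  have "deviations s \<subseteq> ?E"
    unfolding deviations_def
    by (auto intro!: cstar_subalgebra_diff[OF E(1)] E(3) E_mem(4) E_id)
  then obtain \<phi> where \<phi>: "\<phi> \<in> max_ideal_space ?E" "\<And>T. T \<in> deviations s \<Longrightarrow> \<phi> T = 0"
    using character_annihilating[OF E(1,2) E_id assms(1)] by blast
  have "\<phi> ((ds ^^ n) a) = s n a" if "a \<in> A" for n a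
  proof -
    have "(ds ^^ n) a - scaleC_op (s n a) id_blinfun \<in> deviations s"
      unfolding deviations_def using that by force
    then have "\<phi> ((ds ^^ n) a - scaleC_op (s n a) id_blinfun) = 0"
      by (rule \<phi>(2))
    then show ?thesis
      using E(3)[OF that] E_id E_mem(4)[OF E_id]
      by (simp add: character_diff[OF E(1) \<phi>(1)] character_apply(2)[OF \<phi>(1)] character_id[OF \<phi>(1)])
  qed
  then have "xi A U \<phi> n = s n" for n
    by (intro extensionalityI[of _ A] assms(2)) (simp_all add: xi_def)
  then show ?thesis
    using \<phi>(1) by (intro image_eqI[of _ _ \<phi>]) auto
qed

abbreviation ker where "ker \<sigma> \<equiv> {a \<in> A. \<sigma> a = 0}"

lemma alpha_pow_apply: "a \<in> A \<Longrightarrow> (alpha A U ^^ n) \<sigma> a = \<sigma> ((d ^^ n) a)"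
  by (induction n arbitrary: a) (simp_all add: alpha_def[of A U "(alpha A U ^^ k) \<sigma>" for k] d_mem funpow_swap1[of d])

text \<open>
  Since \<open>U U\<^sup>* = \<delta>(1)\<close>, the condition \<open>\<alpha>\<^sup>n\<^sup>-\<^sup>1(\<sigma>) \<in> \<Delta>\<close> says that \<open>\<sigma>(\<delta>\<^sup>n\<^sup>-\<^sup>1(\<delta>(1))) = 1\<close>.
\<close>

lemma Delta_dom_range_proj:
  assumes "\<sigma> \<in> Delta_dom A U n"
  shows "\<sigma> (range_proj n) = 1"
proof (cases n)
  case 0
  then show ?thesis
    using assms character_id A_id by (auto simp: Delta_dom_def)
next
  case (Suc m)
  then have "(alpha A U ^^ m) \<sigma> (U o\<^sub>L adj U) = 1"
    using assms by (auto simp: Delta_dom_def Delta_def)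
  moreover have "U o\<^sub>L adj U = d id_blinfun"
    by (rule blinfun_eqI) (simp add: d_apply)
  ultimately show ?thesis
    using Suc alpha_pow_apply[OF d_mem[OF A_id], of m \<sigma>] by (simp add: funpow_swap1)
qed

text \<open>
  By \<open>ds_pow_apply_w_pow\<close> the operator on the left, applied to \<open>U\<^sup>*\<^sup>n v\<close>, is \<open>U\<^sup>*\<^sup>n S v\<close> with
  \<open>S = \<delta>\<^sup>n\<^sup>-\<^sup>k(a) \<delta>\<^sup>n(1) - \<sigma>(\<delta>\<^sup>n\<^sup>-\<^sup>k(a))\<close>, which lies in the kernel of \<open>\<sigma>\<close>.
\<close>

lemma deviation_dominated:
  assumes \<sigma>: "\<sigma> \<in> Delta_dom A U n" and a: "a \<in> A" "k \<le> n"
  shows "dominated (ker \<sigma>) (\<lambda>v. (norm (blinfun_apply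
    ((ds ^^ k) a - scaleC_op (\<sigma> ((d ^^ (n - k)) a)) id_blinfun) ((w ^^ n) v)))\<^sup>2)"
proof -
  have ch: "\<sigma> \<in> max_ideal_space A"
    using \<sigma> by (simp add: Delta_dom_def)
  define a' where "a' = (d ^^ (n - k)) a"
  have a': "a' \<in> A"
    using a by (simp add: a'_def d_pow_mem)
  define S where "S = (a' o\<^sub>L range_proj n) - scaleC_op (\<sigma> a') id_blinfun"
  have "S \<in> ker \<sigma>"
    using a' range_proj_mem A_id
    by (simp add: S_def cstar_subalgebra_diff[OF A] A_mem character_diff[OF A ch]
        character_apply[OF ch] Delta_dom_range_proj[OF \<sigma>] character_id[OF ch])
  moreover have "norm (blinfun_apply ((ds ^^ k) a - scaleC_op (\<sigma> a') id_blinfun) ((w ^^ n) v))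
      \<le> norm (adj U) ^ n * norm (blinfun_apply S v)" for v
  proof -
    have "blinfun_apply ((ds ^^ k) a - scaleC_op (\<sigma> a') id_blinfun) ((w ^^ n) v)
        = (w ^^ n) (blinfun_apply S v)"
      using a by (simp add: S_def a'_def blinfun.diff_left scaleC_op.rep_eq ds_pow_apply_w_pow
          funpow_blinfun_diff funpow_bounded_ops_scaleC adj_bounded_ops U_op)
    then show ?thesis
      by (simp add: norm_funpow_blinfun)
  qed
  ultimately show ?thesis
    unfolding a'_def[symmetric] by (rule dominated_norm_bound[OF dominated_member])
qed

text \<open>
  The kernel of \<open>\<sigma>\<close> contains \<open>1 - \<delta>\<^sup>n(1)\<close>, so \<open>v \<approx> U\<^sup>n U\<^sup>*\<^sup>n v\<close> and \<open>U\<^sup>*\<^sup>n v\<close> is comparable in norm to \<open>v\<close>.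
\<close>

lemma w_pow_bounded_below:
  assumes \<sigma>: "\<sigma> \<in> Delta_dom A U n"
  shows "dominated (ker \<sigma>) (\<lambda>v. (norm v)\<^sup>2 - 2 * (norm U ^ n)\<^sup>2 * (norm ((w ^^ n) v))\<^sup>2)"
proof (rule dominated_mono)
  have ch: "\<sigma> \<in> max_ideal_space A"
    using \<sigma> by (simp add: Delta_dom_def)
  define S where "S = id_blinfun - range_proj n"
  have "S \<in> ker \<sigma>"
    using range_proj_mem A_id
    by (simp add: S_def cstar_subalgebra_diff[OF A] character_diff[OF A ch]
        Delta_dom_range_proj[OF \<sigma>] character_id[OF ch])
  then show "dominated (ker \<sigma>) (\<lambda>v. 2 * (norm (blinfun_apply S v))\<^sup>2)"
    by (intro dominated_scale dominated_member) auto
  fix v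
  have "v = blinfun_apply S v + (u ^^ n) ((w ^^ n) v)"
    by (simp add: S_def blinfun.diff_left range_proj_apply)
  then have "(norm v)\<^sup>2 \<le> 2 * (norm (blinfun_apply S v))\<^sup>2 + 2 * (norm ((u ^^ n) ((w ^^ n) v)))\<^sup>2"
    using norm_add_sq_le[of "blinfun_apply S v" "(u ^^ n) ((w ^^ n) v)"] by simp
  moreover have "(norm ((u ^^ n) ((w ^^ n) v)))\<^sup>2 \<le> (norm U ^ n)\<^sup>2 * (norm ((w ^^ n) v))\<^sup>2"
    using power_mono[OF norm_funpow_blinfun[where T = U and n = n and x = "(w ^^ n) v"], of 2]
    by (simp add: power_mult_distrib)
  ultimately show "(norm v)\<^sup>2 - 2 * (norm U ^ n)\<^sup>2 * (norm ((w ^^ n) v))\<^sup>2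
      \<le> 2 * (norm (blinfun_apply S v))\<^sup>2"
    by simp
qed

text \<open>
  For \<open>k > n\<close> a further factor \<open>U\<close> acts on \<open>U\<^sup>n U\<^sup>*\<^sup>n v = \<delta>\<^sup>n(1) v\<close>, and \<open>U \<delta>\<^sup>n(1) v = \<delta>\<^sup>n\<^sup>+\<^sup>1(1) U v\<close>. The
  constant matters only in being independent of \<open>v\<close>.
\<close>

lemma ds_pow_apply_w_pow_beyond:
  assumes "n < k"
  shows "norm (blinfun_apply ((ds ^^ k) a) ((w ^^ n) v))
    \<le> (norm (adj U) ^ k * (norm a * (norm U ^ (k - Suc n) * norm (range_proj (Suc n))))) * norm (u v)"
proof -
  define x where "x = blinfun_apply (range_proj (Suc n)) (u v)"
  define y where "y = (u ^^ (k - Suc n)) x"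
  have "(u ^^ k) ((w ^^ n) v) = (u ^^ (k - Suc n)) (u ((u ^^ n) ((w ^^ n) v)))"
    using funpow_split'[of "Suc n" k u "(w ^^ n) v"] assms by simp
  also have "\<dots> = y"
    by (simp only: range_proj_apply u_intertwines[OF range_proj_mem] y_def x_def funpow.simps o_apply)
  finally have "norm (blinfun_apply ((ds ^^ k) a) ((w ^^ n) v)) = norm ((w ^^ k) (blinfun_apply a y))"
    by (simp add: ds_pow_apply)
  also have "\<dots> \<le> norm (adj U) ^ k * norm (blinfun_apply a y)"
    by (rule norm_funpow_blinfun)
  also have "\<dots> \<le> norm (adj U) ^ k * (norm a * norm y)"
    by (intro mult_left_mono norm_blinfun) auto
  also have "\<dots> \<le> norm (adj U) ^ k * (norm a * (norm U ^ (k - Suc n) * norm x))"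
    unfolding y_def by (intro mult_left_mono norm_funpow_blinfun) auto
  also have "\<dots> \<le> norm (adj U) ^ k * (norm a * (norm U ^ (k - Suc n)
      * (norm (range_proj (Suc n)) * norm (u v))))"
    unfolding x_def by (intro mult_left_mono norm_blinfun) auto
  finally show ?thesis
    by (simp only: mult.assoc)
qed

text \<open>
  A character \<open>\<tau>\<close> annihilating the family \<open>J\<close> of the proof would lie in \<open>\<Delta>\<close> and satisfy \<open>\<alpha>(\<tau>) = \<sigma>\<close>. So \<open>J\<close>
  is jointly bounded below. But on a vector \<open>U v\<close> the members of \<open>J\<close> are controlled by the kernel of
  \<open>\<sigma>\<close>, because \<open>\<delta>(a) U v = U a v\<close> and \<open>(1 - U U\<^sup>*) U v = 0\<close>. Hence the kernel controls \<open>\<parallel>U v\<parallel>\<close>, and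
  adjoining \<open>U\<close> to it does not destroy joint singularity.
\<close>

lemma singular_off_image:
  assumes \<sigma>: "\<sigma> \<in> max_ideal_space A" "\<sigma> \<notin> alpha A U ` Delta A U"
  shows "jointly_singular (insert U (ker \<sigma>))"
proof -
  define J where "J = insert (id_blinfun - d id_blinfun) (d ` ker \<sigma>)"
  have "\<not> jointly_singular J"
  proof
    assume J: "jointly_singular J"
    have "J \<subseteq> A"
      unfolding J_def using d_mem A_id cstar_subalgebra_diff[OF A] by auto
    then obtain \<tau> where \<tau>: "\<tau> \<in> max_ideal_space A" "\<And>T. T \<in> J \<Longrightarrow> \<tau> T = 0"
      using character_annihilating[OF A A_comm A_id J] by blast
    have "\<tau> (id_blinfun - d id_blinfun) = 0"
      by (rule \<tau>(2)) (simp add: J_def)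
    then have one: "\<tau> (d id_blinfun) = 1"
      using A_id by (simp add: character_diff[OF A \<tau>(1)] d_mem character_id[OF \<tau>(1)])
    have "U o\<^sub>L adj U = d id_blinfun"
      by (rule blinfun_eqI) (simp add: d_apply)
    then have "\<tau> \<in> Delta A U"
      using \<tau>(1) one by (simp add: Delta_def)
    moreover have "\<tau> (d a) = \<sigma> a" if a: "a \<in> A" for a
    proof -
      have m: "scaleC_op (\<sigma> a) id_blinfun \<in> A"
        by (rule A_mem(4)[OF A_id])
      have "a - scaleC_op (\<sigma> a) id_blinfun \<in> ker \<sigma>"
        using a m by (simp add: cstar_subalgebra_diff[OF A] character_diff[OF A \<sigma>(1)]
            character_apply(2)[OF \<sigma>(1)] A_id character_id[OF \<sigma>(1)])
      then have "\<tau> (d (a - scaleC_op (\<sigma> a) id_blinfun)) = 0"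
        by (intro \<tau>(2)) (simp add: J_def)
      moreover have "d (a - scaleC_op (\<sigma> a) id_blinfun) = d a - scaleC_op (\<sigma> a) (d id_blinfun)"
        using endo a m A_id A_mem(4)[OF m]
        by (simp add: diff_eq_add_scaleC_op star_endomorphism_def)
      ultimately show ?thesis
        using a A_id by (simp add: character_diff[OF A \<tau>(1)] character_apply(2)[OF \<tau>(1)] one
            d_mem A_mem(4))
    qed
    then have "alpha A U \<tau> = \<sigma>"
      by (intro extensionalityI[of _ A] character_apply(4)[OF \<sigma>(1)]) (simp_all add: alpha_def)
    ultimately show False
      using \<sigma>(2) by blast
  qed
  then have J: "dominated J (\<lambda>v. (norm v)\<^sup>2)"
    by (simp add: jointly_singular_def)
  have "dominated (ker \<sigma>) (\<lambda>v. (norm (u v))\<^sup>2)"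
  proof (rule dominated_transfer[OF J])
    fix T
    assume "T \<in> J"
    then consider "T = id_blinfun - d id_blinfun" | a where "a \<in> ker \<sigma>" "T = d a"
      by (auto simp: J_def)
    then show "dominated (ker \<sigma>) (\<lambda>v. (norm (blinfun_apply T (u v)))\<^sup>2)"
    proof cases
      case 1
      then show ?thesis
        by (intro dominated_nonpos) (simp add: blinfun.diff_left d_apply uwu)
    next
      case (2 a)
      then have "blinfun_apply T (u v) = u (blinfun_apply a v)" for v
        by (simp add: u_intertwines)
      then show ?thesis
        using dominated_norm_bound[OF dominated_member[OF 2(1)] norm_blinfun[of U]] by simp
    qed
  qed
  then show ?thesis
    by (intro jointly_singular_transfer[OF kernel_jointly_singular[OF A A_id \<sigma>(1)],
          where W = "\<lambda>v. v" and K = 1]) (auto intro: dominated_nonpos dominated_member)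
qed

lemma chain_apply:
  assumes "\<And>n. 1 \<le> n \<Longrightarrow> n \<le> N \<Longrightarrow> alpha A U (s n) = s (n - 1)" "k \<le> N" "a \<in> A"
  shows "s k a = s N ((d ^^ (N - k)) a)"
proof -
  have "s (N - i) a = s N ((d ^^ i) a)" if "i \<le> N" "a \<in> A" for i a
    using that
  proof (induction i arbitrary: a)
    case (Suc i)
    have "s (N - Suc i) a = alpha A U (s (N - i)) a"
      using assms(1)[of "N - i"] Suc.prems by simp
    also have "\<dots> = s (N - i) (d a)"
      using Suc.prems by (simp add: alpha_def)
    also have "\<dots> = s N ((d ^^ i) (d a))"
      using Suc by (intro Suc.IH) (auto simp: d_mem)
    finally show ?case
      by (simp add: funpow_swap1)
  qed simp
  from this[of "N - k"] show ?thesis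
    using assms by simp
qed

lemma M_infty_realised:
  assumes s: "s \<in> M_infty A U"
  shows "s \<in> xi A U ` max_ideal_space (coefficient_algebra A U)"
proof (rule realised_if_deviations_singular)
  have dom: "s n \<in> Delta_dom A U n" and ch: "s n \<in> max_ideal_space A" for n
    using s by (auto simp: M_infty_def Delta_dom_def)
  show "s n \<in> extensional A" for n
    by (rule character_apply(4)[OF ch])
  show "jointly_singular (deviations s)"
  proof (rule jointly_singular_finite)
    fix F
    assume F: "finite F" "F \<subseteq> deviations s"
    obtain C where C: "finite C" "C \<subseteq> UNIV \<times> A"
      "F = (\<lambda>(n, a). (ds ^^ n) a - scaleC_op (s n a) id_blinfun) ` C"
      using finite_subset_image[OF F[unfolded deviations_def]] by blast
    obtain n where n: "\<And>k. k \<in> fst ` C \<Longrightarrow> k \<le> n"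
      using finite_nat_set_iff_bounded_le[of "fst ` C"] C(1) by auto
    show "jointly_singular F"
    proof (rule jointly_singular_transfer[OF kernel_jointly_singular[OF A A_id ch[of n]]
          _ w_pow_bounded_below[OF dom]])
      fix T
      assume "T \<in> F"
      then obtain k a where "(k, a) \<in> C" and T: "T = (ds ^^ k) a - scaleC_op (s k a) id_blinfun"
        using C(3) by auto
      then have a: "a \<in> A" "k \<le> n"
        using C(2) n by force+
      have "s k a = s n ((d ^^ (n - k)) a)"
        using s a by (intro chain_apply) (auto simp: M_infty_def)
      then show "dominated (ker (s n)) (\<lambda>v. (norm (blinfun_apply T ((w ^^ n) v)))\<^sup>2)"
        using deviation_dominated[OF dom a] T by simp
    qed simp
  qed
qed

text \<open>
  All vectors are obtained with the single exponent \<open>N\<close>: the levels \<open>k \<le> N\<close> are treated as in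
  \<open>M_infty_realised\<close>, and the levels \<open>k > N\<close> are small since \<open>U v\<close> is.
\<close>

lemma M_hat_realised:
  assumes s: "s \<in> M_hat A U N"
  shows "s \<in> xi A U ` max_ideal_space (coefficient_algebra A U)"
proof (rule realised_if_deviations_singular)
  have dom: "s N \<in> Delta_dom A U N" and off: "s N \<notin> alpha A U ` Delta A U"
    and chain: "\<And>n. 1 \<le> n \<Longrightarrow> n \<le> N \<Longrightarrow> alpha A U (s n) = s (n - 1)"
    and beyond: "\<And>n. N < n \<Longrightarrow> s n = zero_functional A"
    using s unfolding M_hat_def Delta_img_1 by auto
  have ch: "s N \<in> max_ideal_space A"
    using dom by (simp add: Delta_dom_def)
  show "s n \<in> extensional A" for n
  proof (cases n N rule: linorder_cases)
    case less
    then have "s n = alpha A U (s (Suc n))"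
      using chain[of "Suc n"] by simp
    then show ?thesis
      by (simp add: alpha_def)
  next
    case equal
    then show ?thesis
      using character_apply(4)[OF ch] by simp
  next
    case greater
    then show ?thesis
      by (simp add: beyond zero_functional_def)
  qed
  show "jointly_singular (deviations s)"
  proof (rule jointly_singular_transfer[OF singular_off_image[OF ch off]])
    show "dominated (insert U (ker (s N)))
        (\<lambda>v. (norm v)\<^sup>2 - 2 * (norm U ^ N)\<^sup>2 * (norm ((w ^^ N) v))\<^sup>2)"
      by (rule dominated_subset[OF w_pow_bounded_below[OF dom]]) auto
    fix T
    assume "T \<in> deviations s"
    then obtain k a where a: "a \<in> A" and T: "T = (ds ^^ k) a - scaleC_op (s k a) id_blinfun"
      by (auto simp: deviations_def)
    show "dominated (insert U (ker (s N))) (\<lambda>v. (norm (blinfun_apply T ((w ^^ N) v)))\<^sup>2)"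
    proof (cases "k \<le> N")
      case True
      have "s k a = s N ((d ^^ (N - k)) a)"
        using chain True a by (rule chain_apply)
      then show ?thesis
        using dominated_subset[OF deviation_dominated[OF dom a True], of "insert U (ker (s N))"] T
        by auto
    next
      case False
      then have "s k a = 0"
        using a by (simp add: beyond zero_functional_def)
      then have "blinfun_apply T x = blinfun_apply ((ds ^^ k) a) x" for x
        by (simp add: T blinfun.diff_left scaleC_op.rep_eq)
      then show ?thesis
        using dominated_norm_bound[OF dominated_member[of U "insert U (ker (s N))"]
            ds_pow_apply_w_pow_beyond[of N k a]] False
        by simp
    qed
  qed simp
qed

end

theorem theorem3p3:
  fixes A :: "('h::complex_hilbert_space \<Rightarrow>\<^sub>L 'h) set" and U :: "'h \<Rightarrow>\<^sub>L 'h"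
  assumes "cstar_subalgebra A" and "commutative_ops A" and "id_blinfun \<in> A"
    and "partial_isometry U"
    and "star_endomorphism A (delta U)"
    and "adj U o\<^sub>L U \<in> commutant A"
  shows "(\<Union>N. M_hat A U N) \<union> M_infty A U \<subseteq> xi A U ` max_ideal_space (coefficient_algebra A U)"
proof -
  interpret partial_isometry_endomorphism A U
    using assms by (rule partial_isometry_endomorphism.intro)
  show ?thesis
    using M_hat_realised M_infty_realised by blast
qed

end
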